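(* Let $u \in W^{1,p}_{g}(\Omega, D)$ and assume that there exists $\omega \in \partial \Phi(u \# \mathcal{L}_\Omega)$ such that $\omega$ can be extended to a convex function on $\mathbb{R}^k$ and such that the Euler--Lagrange equation $$\nabla \cdot DW(\nabla u) - DF(u) = (\nabla \omega)\circ u$$ holds weakly, i.e. for all $v \in W^{1,p}_0(\Omega,\mathbb{R}^k)$, $$\int_\Omega \Big( \nabla v : DW(\nabla u) + v\cdot \big(DF(u) + (\nabla\omega)\circ u\big)\Big)\, \mathrm{d}\mathcal{L}_\Omega = 0$$ (where $\nabla \omega$ can be any measurable selection of the subdifferential of $\omega$). Then $u$ is a global minimizer over $W^{1,p}_g(\Omega,D)$ of the energy $$E(u) = \int_\Omega \big(W(\nabla u) + F(u)\big)\, \mathrm{d}\mathcal{L}_\Omega + \Phi(u\#\mathcal{L}_\Omega).$$ Moreover, if $\omega$, $F$, or $W$ is strictly convex, then $u$ is the unique global minimizer of $E$ over $W^{1,p}_g(\Omega,D)$.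
   Context: Let $\Omega\subset\mathbb{R}^d$ and $D\subset\mathbb{R}^k$ be open bounded domains with Lipschitz boundaries, and $\bar D = D\cup\partial D$. $\mathcal{L}_\Omega$ is the Lebesgue measure restricted to $\Omega$. $\mathcal{M}(X)$ (resp. $\mathcal{M}_+(X)$) is the set of finite Radon measures (resp. positive finite Radon measures) on $X$, with the topology of weak* convergence. $T\#\alpha$ denotes the push-forward of the measure $\alpha$ by $T$. $|\cdot|$ is the Euclidean norm for vectors and the Frobenius norm for matrices, and $A:B$ is the Frobenius inner product. $W:\Omega\times\mathbb{R}^{k\times d}\to\mathbb{R}$ is a Carathéodory function such that, for some $C>0$ and $p>1$, $\frac1C(|H|^p-1)\le W(x,H)\le C(|H|^p+1)$, and $H\mapsto W(x,H)$ is convex for almost every $x\in\Omega$. $F:\Omega\times D\to\mathbb{R}$ is a Carathéodory function such that $\int_\Omega |F(u)|\,\mathrm{d}\mathcal{L}_\Omega<+\infty$ for all $u:\Omega\to D$, and $F$ is convex in its second variable. $DW$ and $DF$ denote the differentials of $W$ and $F$ with respect to their second argument. Strict convexity of $W$ or $F$ likewise refers to the second argument. The dependence on $x$ is suppressed: $W(\nabla u)$ means $W(x,\nabla u(x))$, $F(u)$ means $F(x,u(x))$, and similarly for $DW$, $DF$. The boundary datum $g:\partial\Omega\to\partial D$ is assumed to extend to a function on $\Omega$ with $g(\Omega)=D$. $W^{1,p}_g(\Omega,D)$ is the set of Sobolev functions $u\in W^{1,p}(\Omega,\mathbb{R}^k)$ whose trace on $\partial\Omega$ is $g$ and whose range remains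 in $D$. $\Phi:\mathcal{M}_+(\bar D)\to\mathbb{R}\cup\{+\infty\}$ is convex, bounded below and lower semicontinuous. For $\omega\in C(\bar D)$, its Legendre transform is $\Phi^*(\omega)=\sup_{\mu\in\mathcal{M}(\bar D)}\left(\int\omega\,\mathrm{d}\mu-\Phi(\mu)\right)$, with $\Phi$ understood as $+\infty$ outside $\mathcal{M}_+(\bar D)$. One says that $\omega\in C(\bar D)$ belongs to the subdifferential of $\Phi$ at $\mu$, written $\omega\in\partial\Phi(\mu)$, if $\Phi^*(\omega)=\int\omega\,\mathrm{d}\mu-\Phi(\mu)$; in particular $\partial\Phi(\mu)\neq\emptyset$ is taken to imply $\Phi(\mu)<+\infty$. *)

theory Defs
  imports "HOL-Analysis.Analysis"
begin


section \<open>Surface measure: the Hausdorff measure\<close>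

text \<open>Normalised so that the \<open>d\<close>-dimensional Hausdorff measure agrees with Lebesgue measure on \<open>\<real>\<^sup>d\<close>.
  The empty set is treated separately because of \<open>0 ^ 0 = 1\<close>, and coverings are by bounded sets
  because \<^const>\<open>diameter\<close> is meaningless on unbounded ones.\<close>

definition hausdorff_cost :: "nat \<Rightarrow> 'a::metric_space set \<Rightarrow> ennreal" where
  "hausdorff_cost s C = (if C = {} then 0 else ennreal (unit_ball_vol (real s) * (diameter C / 2) ^ s))"

definition hausdorff_covers :: "real \<Rightarrow> 'a::metric_space set \<Rightarrow> (nat \<Rightarrow> 'a set) set" where
  "hausdorff_covers \<delta> A = {C. A \<subseteq> (\<Union>i. C i) \<and> (\<forall>i. bounded (C i) \<and> diameter (C i) \<le> \<delta>)}"

definition hausdorff_outer :: "nat \<Rightarrow> 'a::metric_space set \<Rightarrow> ennreal" where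
  "hausdorff_outer s A = (SUP \<delta>\<in>{0<..}. INF C\<in>hausdorff_covers \<delta> A. \<Sum>i. hausdorff_cost s (C i))"

definition hausdorff_measure :: "nat \<Rightarrow> 'a::metric_space measure" where
  "hausdorff_measure s = measure_of UNIV (sets borel) (hausdorff_outer s)"

lemma hausdorff_outer_empty: "hausdorff_outer s {} = 0"
proof -
  have "(INF C\<in>hausdorff_covers \<delta> {}. \<Sum>i. hausdorff_cost s (C i :: 'a set)) \<le> 0" if "\<delta> > 0" for \<delta>
    using that by (intro INF_lower2[where i = "\<lambda>_. {}"]) (auto simp: hausdorff_covers_def hausdorff_cost_def)
  then show ?thesis
    unfolding hausdorff_outer_def by (intro antisym SUP_least) auto
qed

lemma hausdorff_outer_mono: "A \<subseteq> B \<Longrightarrow> hausdorff_outer s A \<le> hausdorff_outer s B"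
  unfolding hausdorff_outer_def
  by (intro SUP_mono' INF_superset_mono) (auto simp: hausdorff_covers_def)

lemma hausdorff_outer_subadditive:
  "hausdorff_outer s (\<Union>n. A n) \<le> (\<Sum>n. hausdorff_outer s (A n :: 'a::metric_space set))"
  unfolding hausdorff_outer_def[of s "\<Union>n. A n"]
proof (rule SUP_least)
  fix \<delta> :: real assume \<delta>: "\<delta> \<in> {0<..}"
  define h where "h B = (INF C\<in>hausdorff_covers \<delta> B. \<Sum>i. hausdorff_cost s (C i))" for B :: "'a set"
  have hle: "h B \<le> hausdorff_outer s B" for B
    unfolding hausdorff_outer_def h_def using \<delta> by (intro SUP_upper)
  have "h (\<Union>n. A n) \<le> (\<Sum>n. h (A n))"
  proof (rule ennreal_le_epsilon)
    fix e :: real assume e: "0 < e" and fin: "(\<Sum>n. h (A n)) < top"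
    have hfin: "h (A n) < top" for n
      using ennreal_suminf_lessD[OF fin] by blast
    have "\<exists>C\<in>hausdorff_covers \<delta> (A n). (\<Sum>i. hausdorff_cost s (C i)) < h (A n) + ennreal (e * (1/2)^Suc n)" for n
    proof -
      have "h (A n) < h (A n) + ennreal (e * (1/2)^Suc n)"
        using hfin[of n] e by (simp add: ennreal_add_left_cancel_less[of _ 0, simplified])
      then show ?thesis
        unfolding h_def by (subst (asm) INF_less_iff) blast
    qed
    then obtain C where C: "C n \<in> hausdorff_covers \<delta> (A n)"
      and Cs: "(\<Sum>i. hausdorff_cost s (C n i)) < h (A n) + ennreal (e * (1/2)^Suc n)" for n
      by metis
    define K where "K i = (case prod_decode i of (n, j) \<Rightarrow> C n j)" for i
    have "K \<in> hausdorff_covers \<delta> (\<Union>n. A n)"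
    proof -
      have "x \<in> (\<Union>i. K i)" if "x \<in> A n" for x n
      proof -
        from C[of n] that obtain j where "x \<in> C n j" by (auto simp: hausdorff_covers_def)
        then have "x \<in> K (prod_encode (n, j))" by (simp add: K_def)
        then show ?thesis by blast
      qed
      moreover have "bounded (K i) \<and> diameter (K i) \<le> \<delta>" for i
        using C by (auto simp: K_def hausdorff_covers_def split: prod.splits)
      ultimately show ?thesis by (auto simp: hausdorff_covers_def)
    qed
    then have "h (\<Union>n. A n) \<le> (\<Sum>i. hausdorff_cost s (K i))"
      unfolding h_def by (rule INF_lower)
    also have "\<dots> = (\<Sum>n. \<Sum>j. hausdorff_cost s (C n j))"
      using suminf_ennreal_2dimen[of "\<lambda>n. \<Sum>j. hausdorff_cost s (C n j)" "\<lambda>(n, j). hausdorff_cost s (C n j)"]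
      by (simp add: K_def split_beta)
    also have "\<dots> \<le> (\<Sum>n. h (A n) + ennreal (e * (1/2)^Suc n))"
      using Cs by (intro suminf_le) (auto intro: less_imp_le)
    also have "\<dots> = (\<Sum>n. h (A n)) + (\<Sum>n. ennreal (e * (1/2)^Suc n))"
      by (intro suminf_add[symmetric]) auto
    also have "(\<Sum>n. ennreal (e * (1/2)^Suc n)) = ennreal e"
    proof (rule suminf_ennreal_eq)
      show "(\<lambda>n. e * (1/2)^Suc n) sums e"
        using sums_mult[OF power_half_series, of e] by simp
    qed (use e in auto)
    finally show "h (\<Union>n. A n) \<le> (\<Sum>n. h (A n)) + ennreal e" .
  qed
  also have "\<dots> \<le> (\<Sum>n. hausdorff_outer s (A n))"
    by (intro suminf_le hle) auto
  finally show "(INF C\<in>hausdorff_covers \<delta> (\<Union>n. A n). \<Sum>i. hausdorff_cost s (C i)) \<le> (\<Sum>n. hausdorff_outer s (A n))"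
    by (simp add: h_def)
qed

lemma hausdorff_outer_space: "outer_measure_space UNIV (hausdorff_outer s)"
  unfolding outer_measure_space_def positive_def increasing_def countably_subadditive_def
  using hausdorff_outer_empty hausdorff_outer_mono hausdorff_outer_subadditive by blast

lemma hausdorff_outer_Un_le:
  "hausdorff_outer s (A \<union> B) \<le> hausdorff_outer s A + hausdorff_outer s B"
proof -
  have "(\<Union>n. binaryset A B n) = A \<union> B" by (simp add: UN_binaryset_eq)
  then have "hausdorff_outer s (A \<union> B) \<le> (\<Sum>n. hausdorff_outer s (binaryset A B n))"
    using hausdorff_outer_subadditive[of s "binaryset A B"] by simp
  also have "\<dots> = hausdorff_outer s A + hausdorff_outer s B"
    by (rule suminf_binaryset_eq) (simp add: hausdorff_outer_empty)
  finally show ?thesis .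
qed

lemma hausdorff_outer_separated:
  assumes sep: "\<eta> > 0" "\<And>x y. x \<in> A \<Longrightarrow> y \<in> B \<Longrightarrow> \<eta> \<le> dist x y"
  shows "hausdorff_outer s A + hausdorff_outer s B \<le> hausdorff_outer s (A \<union> B)"
proof -
  define h where "h \<delta> D = (INF C\<in>hausdorff_covers \<delta> D. \<Sum>i. hausdorff_cost s (C i))" for \<delta> and D :: "'a set"
  have anti: "h \<delta>' D \<le> h \<delta> D" if "\<delta> \<le> \<delta>'" for \<delta> \<delta>' D
    unfolding h_def using that by (intro INF_superset_mono) (auto simp: hausdorff_covers_def intro: order_trans)
  have outer: "hausdorff_outer s D = (SUP \<delta>\<in>{0<..}. h \<delta> D)" for D
    by (simp add: hausdorff_outer_def h_def)
  have key: "h \<delta> A + h \<delta> B \<le> h \<delta> (A \<union> B)" if "0 < \<delta>" "\<delta> < \<eta>" for \<delta>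
    unfolding h_def[of \<delta> "A \<union> B"]
  proof (rule INF_greatest)
    fix C assume C: "C \<in> hausdorff_covers \<delta> (A \<union> B)"
    define CA where "CA i = (if C i \<inter> A = {} then {} else C i)" for i
    define CB where "CB i = (if C i \<inter> B = {} then {} else C i)" for i
    have "CA \<in> hausdorff_covers \<delta> A"
      using C that unfolding hausdorff_covers_def CA_def by (auto split: if_splits) blast
    moreover have "CB \<in> hausdorff_covers \<delta> B"
      using C that unfolding hausdorff_covers_def CB_def by (auto split: if_splits) blast
    ultimately have "h \<delta> A + h \<delta> B \<le> (\<Sum>i. hausdorff_cost s (CA i)) + (\<Sum>i. hausdorff_cost s (CB i))"
      unfolding h_def by (intro add_mono INF_lower)
    also have "\<dots> = (\<Sum>i. hausdorff_cost s (CA i) + hausdorff_cost s (CB i))"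
      by (intro suminf_add) auto
    also have "\<dots> \<le> (\<Sum>i. hausdorff_cost s (C i))"
    proof (intro suminf_le)
      fix i
      have "C i \<inter> A = {} \<or> C i \<inter> B = {}"
      proof (rule ccontr)
        assume "\<not> ?thesis"
        then obtain x y where xy: "x \<in> C i" "x \<in> A" "y \<in> C i" "y \<in> B" by auto
        have "dist x y \<le> diameter (C i)"
          using C xy by (intro diameter_bounded_bound) (auto simp: hausdorff_covers_def)
        also have "\<dots> \<le> \<delta>" using C by (auto simp: hausdorff_covers_def)
        finally show False using sep(2)[of x y] xy that by simp
      qed
      then show "hausdorff_cost s (CA i) + hausdorff_cost s (CB i) \<le> hausdorff_cost s (C i)"
        by (auto simp: CA_def CB_def hausdorff_cost_def)
    qed auto
    finally show "h \<delta> A + h \<delta> B \<le> (\<Sum>i. hausdorff_cost s (C i))" .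
  qed
  have "hausdorff_outer s A + hausdorff_outer s B = (SUP \<delta>\<in>{0<..}. h \<delta> A + h \<delta> B)"
    unfolding outer
  proof (rule SUP_add_directed_ennreal[symmetric])
    fix i j :: real assume ij: "i \<in> {0<..}" "j \<in> {0<..}"
    then show "\<exists>k\<in>{0<..}. h i A + h j B \<le> h k A + h k B"
      by (intro bexI[of _ "min i j"] add_mono anti) auto
  qed
  also have "\<dots> \<le> hausdorff_outer s (A \<union> B)"
    unfolding outer
  proof (intro SUP_mono)
    fix \<delta> :: real assume "\<delta> \<in> {0<..}"
    define m where "m = min \<delta> (\<eta>/2)"
    have "h \<delta> A + h \<delta> B \<le> h m A + h m B" by (intro add_mono anti) (auto simp: m_def)
    also have "\<dots> \<le> h m (A \<union> B)" using \<open>\<delta> \<in> _\<close> sep(1) by (intro key) (auto simp: m_def)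
    finally show "\<exists>m\<in>{0<..}. h \<delta> A + h \<delta> B \<le> h m (A \<union> B)"
      using \<open>\<delta> \<in> _\<close> sep(1) by (intro bexI[of _ m]) (auto simp: m_def)
  qed
  finally show ?thesis .
qed


lemma closed_hausdorff_measurable:
  fixes F :: "'a::metric_space set"
  assumes F: "closed F"
  shows "F \<in> lambda_system UNIV UNIV (hausdorff_outer s)"
proof (cases "F = {}")
  case True
  then show ?thesis by (simp add: lambda_system_def hausdorff_outer_empty)
next
  case F0: False
  define \<mu> :: "'a set \<Rightarrow> ennreal" where "\<mu> = hausdorff_outer s"
  have mono: "\<mu> A \<le> \<mu> B" if "A \<subseteq> B" for A B
    using that by (simp add: \<mu>_def hausdorff_outer_mono)
  have sub: "\<mu> (A \<union> B) \<le> \<mu> A + \<mu> B" for A B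
    by (simp add: \<mu>_def hausdorff_outer_Un_le)
  have csub: "\<mu> (\<Union>n. A n) \<le> (\<Sum>n. \<mu> (A n))" for A
    by (simp add: \<mu>_def hausdorff_outer_subadditive)
  have sep: "\<mu> A + \<mu> B \<le> \<mu> (A \<union> B)"
    if "\<eta> > 0" "\<And>x y. x \<in> A \<Longrightarrow> y \<in> B \<Longrightarrow> \<eta> \<le> dist x y" for \<eta> A B
    unfolding \<mu>_def using that by (rule hausdorff_outer_separated)
  have "\<mu> (T \<inter> F) + \<mu> (T - F) \<le> \<mu> T" for T
  proof (cases "\<mu> T = top")
    case False
    define d where "d x = infdist x F" for x
    define r where "r n = 1 / real (Suc n)" for n
    define R where "R n = {x \<in> T. r (Suc n) \<le> d x \<and> d x < r n}" for n
    define G where "G n = {x \<in> T. r n \<le> d x}" for n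
    have r_pos: "r n > 0" for n by (simp add: r_def)
    have r_dec: "r n \<le> r m" if "m \<le> n" for m n
      using that by (simp add: r_def frac_le)
    have r_less: "r (Suc n) < r n" for n
      by (simp add: r_def frac_less2)
    have dlip: "d x \<le> d y + dist x y" for x y
      unfolding d_def by (rule infdist_triangle)
    have bnd: "(\<Sum>k<n. \<mu> (R (2 * k + i))) \<le> \<mu> T" for n i
    proof -
      have "(\<Sum>k<n. \<mu> (R (2 * k + i))) \<le> \<mu> (\<Union>k<n. R (2 * k + i))"
      proof (induction n)
        case 0 show ?case by simp
      next
        case (Suc n)
        let ?\<eta> = "r (2 * n + i) - r (Suc (2 * n + i))"
        have "\<mu> (\<Union>k<n. R (2 * k + i)) + \<mu> (R (2 * n + i))
            \<le> \<mu> ((\<Union>k<n. R (2 * k + i)) \<union> R (2 * n + i))"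
        proof (cases n)
          case 0 then show ?thesis by (simp add: \<mu>_def hausdorff_outer_empty)
        next
          case (Suc m)
          show ?thesis
          proof (rule sep)
            show "0 < r (2 * m + 1 + i) - r (2 * n + i)"
              using r_less[of "2 * m + 1 + i"] Suc by simp
            fix x y assume "x \<in> (\<Union>k<n. R (2 * k + i))" and y: "y \<in> R (2 * n + i)"
            then obtain k where "k \<le> m" and x: "x \<in> R (2 * k + i)" using Suc by (auto simp: less_Suc_eq_le)
            then have "r (2 * m + 1 + i) \<le> r (Suc (2 * k + i))" by (intro r_dec) auto
            also have "\<dots> \<le> d x" using x by (simp add: R_def)
            also have "\<dots> \<le> d y + dist x y" by (rule dlip)
            also have "d y \<le> r (2 * n + i)" using y by (simp add: R_def)
            finally show "r (2 * m + 1 + i) - r (2 * n + i) \<le> dist x y" by simp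
          qed
        qed
        then show ?case using Suc
          by (simp add: lessThan_Suc Un_commute add.commute) (meson add_left_mono order_trans)
      qed
      also have "\<dots> \<le> \<mu> T" by (intro mono) (auto simp: R_def)
      finally show ?thesis .
    qed
    have tot: "(\<Sum>n. \<mu> (R n)) < top"
    proof -
      have "(\<Sum>n. \<mu> (R n)) \<le> \<mu> T + \<mu> T"
      proof (rule suminf_le_const)
        fix n
        have "(\<Sum>k<n. \<mu> (R k)) \<le> (\<Sum>k<2 * n. \<mu> (R k))"
          by (rule sum_mono2) auto
        also have "\<dots> = (\<Sum>k<n. \<mu> (R (2 * k + 0))) + (\<Sum>k<n. \<mu> (R (2 * k + 1)))"
          by (induction n) (simp_all add: algebra_simps)
        also have "\<dots> \<le> \<mu> T + \<mu> T" by (intro add_mono bnd)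
        finally show "(\<Sum>k<n. \<mu> (R k)) \<le> \<mu> T + \<mu> T" .
      qed simp
      also have "\<dots> < top" using False by (simp add: less_top[symmetric])
      finally show ?thesis .
    qed
    have cover: "T - F \<subseteq> G n \<union> (\<Union>k. R (k + n))" for n
    proof
      fix x assume x: "x \<in> T - F"
      then have dpos: "0 < d x"
        using F F0 by (simp add: d_def infdist_pos_not_in_closed)
      show "x \<in> G n \<union> (\<Union>k. R (k + n))"
      proof (cases "r n \<le> d x")
        case True then show ?thesis using x by (simp add: G_def)
      next
        case less: False
        obtain N where "inverse (real (Suc N)) < d x"
          using reals_Archimedean[OF dpos] by blast
        then have "r N < d x" by (simp only: r_def inverse_eq_divide)
        define m where "m = (LEAST m. r m \<le> d x)"
        have m: "r m \<le> d x"
          unfolding m_def using LeastI[of "\<lambda>m. r m \<le> d x" N] \<open>r N < d x\<close> by simp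
        have "n < m"
        proof (rule ccontr)
          assume "\<not> n < m"
          then have "r n \<le> r m" by (intro r_dec) simp
          with m less show False by simp
        qed
        then have k: "m = Suc ((m - Suc n) + n)" by simp
        define k where "k = m - Suc n"
        have k: "m = Suc (k + n)" using k by (simp only: k_def)
        have "\<not> r (k + n) \<le> d x"
          using not_less_Least[of "k + n" "\<lambda>m. r m \<le> d x"] k[unfolded m_def] by (simp only: m_def[symmetric]) simp
        then have "x \<in> R (k + n)" using x m k by (simp add: R_def)
        then show ?thesis by blast
      qed
    qed
    have le: "\<mu> (T \<inter> F) + \<mu> (T - F) \<le> \<mu> T + (\<Sum>k. \<mu> (R (k + n)))" for n
    proof -
      have "\<mu> (T - F) \<le> \<mu> (G n) + \<mu> (\<Union>k. R (k + n))"
        using mono[OF cover] sub by (rule order_trans)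
      also have "\<dots> \<le> \<mu> (G n) + (\<Sum>k. \<mu> (R (k + n)))"
        by (intro add_left_mono csub)
      finally have "\<mu> (T \<inter> F) + \<mu> (T - F) \<le> (\<mu> (T \<inter> F) + \<mu> (G n)) + (\<Sum>k. \<mu> (R (k + n)))"
        by (simp add: add.assoc add_left_mono)
      also have "\<mu> (T \<inter> F) + \<mu> (G n) \<le> \<mu> ((T \<inter> F) \<union> G n)"
      proof (rule sep[OF r_pos])
        fix x y assume "x \<in> T \<inter> F" "y \<in> G n"
        then show "r n \<le> dist x y"
          using infdist_le[of x F y] by (auto simp: G_def d_def dist_commute)
      qed
      also have "\<dots> \<le> \<mu> T" by (intro mono) (auto simp: G_def)
      finally show ?thesis by (simp add: add_right_mono)
    qed
    let ?S = "\<Sum>n. \<mu> (R n)" and ?X = "\<mu> (T \<inter> F) + \<mu> (T - F)"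
    have "?X + (\<Sum>k<n. \<mu> (R k)) \<le> \<mu> T + ?S" for n
    proof -
      have "?X + (\<Sum>k<n. \<mu> (R k)) \<le> \<mu> T + (\<Sum>k. \<mu> (R (k + n))) + (\<Sum>k<n. \<mu> (R k))"
        by (intro add_right_mono le)
      also have "\<dots> = \<mu> T + ?S"
        by (subst suminf_offset[of "\<lambda>n. \<mu> (R n)" n]) (simp_all add: add.assoc add.commute)
      finally show ?thesis .
    qed
    then have "(SUP n. ?X + (\<Sum>k<n. \<mu> (R k))) \<le> \<mu> T + ?S"
      by (intro SUP_least)
    then have "?X + ?S \<le> \<mu> T + ?S"
      by (simp add: ennreal_SUP_add_right suminf_eq_SUP)
    then show ?thesis
      using tot by (auto simp: add.commute[of _ ?S])
  qed (simp add: top_unique)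
  moreover have "\<mu> T \<le> \<mu> (T \<inter> F) + \<mu> (T - F)" for T
    using sub[of "T \<inter> F" "T - F"] by (simp add: Int_Diff_Un)
  ultimately have "\<mu> (F \<inter> T) + \<mu> ((UNIV - F) \<inter> T) = \<mu> T" for T
    by (metis Compl_eq_Diff_UNIV Diff_eq Int_commute antisym)
  then show ?thesis by (simp add: lambda_system_def \<mu>_def)
qed

text \<open>Hence \<open>hausdorff_measure\<close> is not the degenerate measure that \<open>measure_of\<close> would return
  for a set function that is not countably additive.\<close>

lemma sets_hausdorff_measure [simp]: "sets (hausdorff_measure s) = sets borel"
  by (simp add: hausdorff_measure_def) (metis sets.sigma_sets_eq space_borel)

lemma emeasure_hausdorff_measure:
  fixes A :: "'a::metric_space set"
  assumes "A \<in> sets borel"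
  shows "emeasure (hausdorff_measure s) A = hausdorff_outer s A"
proof -
  interpret sigma_algebra UNIV "UNIV :: 'a set set"
    using sigma_algebra_Pow[of "UNIV :: 'a set"] by simp
  define L where "L = lambda_system UNIV UNIV (hausdorff_outer s :: 'a set \<Rightarrow> ennreal)"
  have meas: "measure_space UNIV L (hausdorff_outer s)"
    unfolding L_def by (rule caratheodory_lemma[OF hausdorff_outer_space])
  then have "sigma_algebra UNIV L"
    by (simp add: measure_space_def)
  then have "sigma_sets UNIV (Collect closed) \<subseteq> L"
    by (rule sigma_algebra.sigma_sets_subset) (auto simp: L_def intro: closed_hausdorff_measurable)
  then have sub: "sets borel \<subseteq> L"
    by (simp add: borel_eq_closed)
  have "positive (sets borel) (hausdorff_outer s :: 'a set \<Rightarrow> ennreal)"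
    by (simp add: positive_def hausdorff_outer_empty)
  moreover have "countably_additive (sets borel) (hausdorff_outer s :: 'a set \<Rightarrow> ennreal)"
    using meas sub unfolding measure_space_def countably_additive_def
    by (meson subset_trans subsetD)
  ultimately show ?thesis
    using assms by (intro emeasure_measure_of[OF hausdorff_measure_def]) auto
qed

text \<open>Surface measure on the boundary; its completion is taken so that trace functions need only
  be measurable up to null sets.\<close>

definition surface_measure :: "(real ^ 'd) set \<Rightarrow> (real ^ 'd) measure" where
  "surface_measure \<Omega> = restrict_space (completion (hausdorff_measure (CARD('d) - 1))) (frontier \<Omega>)"


section \<open>Lipschitz domains\<close>

text \<open>Near each boundary point, \<open>S\<close> is the strict epigraph, in the direction of a unit vector \<open>e\<close>,
  of a Lipschitz function \<open>\<gamma>\<close> on the hyperplane orthogonal to \<open>e\<close>.\<close>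

definition lipschitz_boundary :: "'a::euclidean_space set \<Rightarrow> bool" where
  "lipschitz_boundary S \<longleftrightarrow>
    (\<forall>x\<in>frontier S. \<exists>r>0. \<exists>e \<gamma> L. norm e = 1 \<and> L-lipschitz_on {z. z \<bullet> e = 0} \<gamma> \<and>
      S \<inter> ball x r = {y \<in> ball x r. \<gamma> (y - (y \<bullet> e) *\<^sub>R e) < y \<bullet> e})"

definition bounded_lipschitz_domain :: "'a::euclidean_space set \<Rightarrow> bool" where
  "bounded_lipschitz_domain S \<longleftrightarrow>
    open S \<and> connected S \<and> S \<noteq> {} \<and> bounded S \<and> lipschitz_boundary S"


section \<open>Sobolev spaces\<close>

text \<open>Matrices in \<open>\<real>\<^sup>k\<^sup>\<times>\<^sup>d\<close> have type \<open>real ^ 'd ^ 'k\<close>; on this type \<^const>\<open>norm\<close> and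
  \<open>(\<bullet>)\<close> are the Frobenius norm and inner product.\<close>

definition has_C1_gradient :: "(real ^ 'd \<Rightarrow> real) \<Rightarrow> (real ^ 'd \<Rightarrow> real ^ 'd) \<Rightarrow> bool" where
  "has_C1_gradient \<phi> \<phi>' \<longleftrightarrow> (\<forall>x. GDERIV \<phi> x :> \<phi>' x) \<and> continuous_on UNIV \<phi>'"

definition has_C1_jacobian :: "(real ^ 'd \<Rightarrow> real ^ 'k) \<Rightarrow> (real ^ 'd \<Rightarrow> real ^ 'd ^ 'k) \<Rightarrow> bool" where
  "has_C1_jacobian \<phi> J \<longleftrightarrow> (\<forall>x. (\<phi> has_derivative (\<lambda>h. J x *v h)) (at x)) \<and> continuous_on UNIV J"

definition locally_integrable :: "(real ^ 'd) set \<Rightarrow> (real ^ 'd \<Rightarrow> 'b::euclidean_space) \<Rightarrow> bool" where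
  "locally_integrable \<Omega> f \<longleftrightarrow> (\<forall>K. compact K \<longrightarrow> K \<subseteq> \<Omega> \<longrightarrow> set_integrable lebesgue K f)"

text \<open>Test functions are continuously differentiable with compact support in \<open>\<Omega>\<close>.\<close>

definition has_weak_gradient ::
  "(real ^ 'd) set \<Rightarrow> (real ^ 'd \<Rightarrow> real ^ 'k) \<Rightarrow> (real ^ 'd \<Rightarrow> real ^ 'd ^ 'k) \<Rightarrow> bool" where
  "has_weak_gradient \<Omega> u G \<longleftrightarrow> locally_integrable \<Omega> u \<and> locally_integrable \<Omega> G \<and>
    (\<forall>\<phi> \<phi>'. has_C1_gradient \<phi> \<phi>' \<longrightarrow> compact (closure {x. \<phi> x \<noteq> 0}) \<longrightarrow> closure {x. \<phi> x \<noteq> 0} \<subseteq> \<Omega> \<longrightarrow>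
      (\<forall>i j. (LINT x|lebesgue_on \<Omega>. (u x $ i) * (\<phi>' x $ j)) =
           - (LINT x|lebesgue_on \<Omega>. (G x $ i $ j) * \<phi> x)))"

text \<open>The weak gradient is unique up to null sets.\<close>

definition weak_grad :: "(real ^ 'd) set \<Rightarrow> (real ^ 'd \<Rightarrow> real ^ 'k) \<Rightarrow> real ^ 'd \<Rightarrow> real ^ 'd ^ 'k" where
  "weak_grad \<Omega> u = (SOME G. has_weak_gradient \<Omega> u G)"

definition Lp_fun :: "'a measure \<Rightarrow> real \<Rightarrow> ('a \<Rightarrow> 'b::euclidean_space) \<Rightarrow> bool" where
  "Lp_fun M p f \<longleftrightarrow> f \<in> borel_measurable M \<and> integrable M (\<lambda>x. norm (f x) powr p)"

definition Lp_tendsto ::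
  "'a measure \<Rightarrow> real \<Rightarrow> (nat \<Rightarrow> 'a \<Rightarrow> 'b::euclidean_space) \<Rightarrow> ('a \<Rightarrow> 'b) \<Rightarrow> bool" where
  "Lp_tendsto M p f g \<longleftrightarrow> (\<lambda>n. \<integral>\<^sup>+x. ennreal (norm (f n x - g x) powr p) \<partial>M) \<longlonglongrightarrow> 0"

definition sobolev :: "(real ^ 'd) set \<Rightarrow> real \<Rightarrow> (real ^ 'd \<Rightarrow> real ^ 'k) set" where
  "sobolev \<Omega> p = {u. Lp_fun (lebesgue_on \<Omega>) p u \<and>
    (\<exists>G. has_weak_gradient \<Omega> u G \<and> Lp_fun (lebesgue_on \<Omega>) p G)}"

text \<open>The trace operator is the continuous extension to the Sobolev space, with values in
  \<open>L\<^sup>p(\<partial>\<Omega>)\<close>, of the restriction to \<open>\<partial>\<Omega>\<close> of functions that are \<open>C\<^sup>1\<close> up to the boundary.\<close>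

definition has_trace ::
  "(real ^ 'd) set \<Rightarrow> real \<Rightarrow> (real ^ 'd \<Rightarrow> real ^ 'k) \<Rightarrow> (real ^ 'd \<Rightarrow> real ^ 'k) \<Rightarrow> bool" where
  "has_trace \<Omega> p u g \<longleftrightarrow> g \<in> borel_measurable (surface_measure \<Omega>) \<and>
    (\<exists>\<phi> J. (\<forall>n. has_C1_jacobian (\<phi> n) (J n)) \<and>
      Lp_tendsto (lebesgue_on \<Omega>) p \<phi> u \<and>
      Lp_tendsto (lebesgue_on \<Omega>) p J (weak_grad \<Omega> u) \<and>
      Lp_tendsto (surface_measure \<Omega>) p \<phi> g)"

definition sobolev_bdry ::
  "(real ^ 'd) set \<Rightarrow> (real ^ 'k) set \<Rightarrow> real \<Rightarrow> (real ^ 'd \<Rightarrow> real ^ 'k) \<Rightarrow> (real ^ 'd \<Rightarrow> real ^ 'k) set" where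
  "sobolev_bdry \<Omega> D p g = {u \<in> sobolev \<Omega> p. has_trace \<Omega> p u g \<and> (AE x in lebesgue_on \<Omega>. u x \<in> D)}"

abbreviation sobolev_zero :: "(real ^ 'd) set \<Rightarrow> real \<Rightarrow> (real ^ 'd \<Rightarrow> real ^ 'k) set" where
  "sobolev_zero \<Omega> p \<equiv> sobolev_bdry \<Omega> UNIV p (\<lambda>_. 0)"


section \<open>Convexity and integrands\<close>

text \<open>Convexity on a set \<open>S\<close> that need not be convex: \<open>f\<close> is the restriction of a convex function on the
  convex hull. For convex \<open>S\<close> this is \<^const>\<open>convex_on\<close>.\<close>

definition convex_fun_on :: "'a::real_vector set \<Rightarrow> ('a \<Rightarrow> real) \<Rightarrow> bool" where
  "convex_fun_on S f \<longleftrightarrow> (\<exists>h. convex_on (convex hull S) h \<and> (\<forall>y\<in>S. h y = f y))"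

definition strictly_convex_fun_on :: "'a::real_vector set \<Rightarrow> ('a \<Rightarrow> real) \<Rightarrow> bool" where
  "strictly_convex_fun_on S f \<longleftrightarrow> convex_fun_on S f \<and>
    (\<forall>x\<in>S. \<forall>y\<in>S. \<forall>t. x \<noteq> y \<longrightarrow> 0 < t \<longrightarrow> t < 1 \<longrightarrow> (1 - t) *\<^sub>R x + t *\<^sub>R y \<in> S \<longrightarrow>
      f ((1 - t) *\<^sub>R x + t *\<^sub>R y) < (1 - t) * f x + t * f y)"

definition convex_subdifferential :: "('a::real_inner \<Rightarrow> real) \<Rightarrow> 'a \<Rightarrow> 'a set" where
  "convex_subdifferential f y = {\<xi>. \<forall>z. f y + \<xi> \<bullet> (z - y) \<le> f z}"

definition caratheodory_fun ::
  "(real ^ 'd) set \<Rightarrow> 'b::euclidean_space set \<Rightarrow> (real ^ 'd \<Rightarrow> 'b \<Rightarrow> real) \<Rightarrow> bool" where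
  "caratheodory_fun \<Omega> S f \<longleftrightarrow>
    (\<forall>y\<in>S. (\<lambda>x. f x y) \<in> borel_measurable (lebesgue_on \<Omega>)) \<and>
    (AE x in lebesgue_on \<Omega>. continuous_on S (f x))"


section \<open>Functionals on positive measures\<close>

text \<open>\<open>\<M>\<^sub>+(closure D)\<close>: a positive finite Radon measure on \<open>closure D\<close> is represented by a
  finite Borel measure on the whole space that does not charge the complement of \<open>closure D\<close>.
  As \<open>closure D\<close> will be compact, finite Borel measures on it are Radon.\<close>

definition pos_measures :: "'a::euclidean_space set \<Rightarrow> 'a measure set" where
  "pos_measures D = {\<mu>. sets \<mu> = sets borel \<and> finite_measure \<mu> \<and> emeasure \<mu> (- closure D) = 0}"

definition weak_star_topology :: "'a::euclidean_space set \<Rightarrow> 'a measure topology" where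
  "weak_star_topology D = pullback_topology (pos_measures D)
    (\<lambda>\<mu>. \<lambda>f\<in>{f. continuous_on (closure D) f}. LINT y:closure D|\<mu>. f y)
    (product_topology (\<lambda>_. euclideanreal) {f. continuous_on (closure D) f})"

definition weak_star_lsc :: "'a::euclidean_space set \<Rightarrow> ('a measure \<Rightarrow> ereal) \<Rightarrow> bool" where
  "weak_star_lsc D \<Phi> \<longleftrightarrow> (\<forall>c. openin (weak_star_topology D) {\<mu> \<in> pos_measures D. c < \<Phi> \<mu>})"

text \<open>Here \<open>\<rho>\<close> is the measure \<open>(1 - t) \<mu> + t \<nu>\<close>.\<close>

definition convex_on_measures :: "'a::euclidean_space set \<Rightarrow> ('a measure \<Rightarrow> ereal) \<Rightarrow> bool" where
  "convex_on_measures D \<Phi> \<longleftrightarrow>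
    (\<forall>\<mu>\<in>pos_measures D. \<forall>\<nu>\<in>pos_measures D. \<forall>\<rho>\<in>pos_measures D. \<forall>t\<in>{0..1}.
      (\<forall>A\<in>sets borel. measure \<rho> A = (1 - t) * measure \<mu> A + t * measure \<nu> A) \<longrightarrow>
      \<Phi> \<rho> \<le> ereal (1 - t) * \<Phi> \<mu> + ereal t * \<Phi> \<nu>)"

text \<open>Only positive measures enter the supremum: \<open>\<Phi>\<close> is \<open>+\<infinity>\<close> at all other signed measures,
  which therefore contribute \<open>-\<infinity>\<close>.\<close>

definition legendre_transform ::
  "'a::euclidean_space set \<Rightarrow> ('a measure \<Rightarrow> ereal) \<Rightarrow> ('a \<Rightarrow> real) \<Rightarrow> ereal" where
  "legendre_transform D \<Phi> \<omega> = (SUP \<mu>\<in>pos_measures D. ereal (LINT y:closure D|\<mu>. \<omega> y) - \<Phi> \<mu>)"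

definition measure_subdifferential ::
  "'a::euclidean_space set \<Rightarrow> ('a measure \<Rightarrow> ereal) \<Rightarrow> 'a measure \<Rightarrow> ('a \<Rightarrow> real) set" where
  "measure_subdifferential D \<Phi> \<mu> = {\<omega>. continuous_on (closure D) \<omega> \<and> \<Phi> \<mu> < \<infinity> \<and>
    legendre_transform D \<Phi> \<omega> = ereal (LINT y:closure D|\<mu>. \<omega> y) - \<Phi> \<mu>}"


section \<open>The energy\<close>

definition push_lebesgue ::
  "(real ^ 'd) set \<Rightarrow> (real ^ 'd \<Rightarrow> real ^ 'k) \<Rightarrow> (real ^ 'k) measure" where
  "push_lebesgue \<Omega> u = distr (lebesgue_on \<Omega>) borel u"

definition energy ::
  "(real ^ 'd) set \<Rightarrow> (real ^ 'd \<Rightarrow> real ^ 'd ^ 'k \<Rightarrow> real) \<Rightarrow> (real ^ 'd \<Rightarrow> real ^ 'k \<Rightarrow> real) \<Rightarrow>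
    ((real ^ 'k) measure \<Rightarrow> ereal) \<Rightarrow> (real ^ 'd \<Rightarrow> real ^ 'k) \<Rightarrow> ereal" where
  "energy \<Omega> W F \<Phi> u =
    ereal (LINT x|lebesgue_on \<Omega>. W x (weak_grad \<Omega> u x) + F x (u x)) + \<Phi> (push_lebesgue \<Omega> u)"

definition is_global_minimizer :: "('a \<Rightarrow> ereal) \<Rightarrow> 'a set \<Rightarrow> 'a \<Rightarrow> bool" where
  "is_global_minimizer E S u \<longleftrightarrow> u \<in> S \<and> (\<forall>w\<in>S. E u \<le> E w)"

end

theory Submission
  imports Defs
begin

text \<open>
  Why a solution of the Euler--Lagrange equation is a minimizer: everything in the energy is convex and
  lies above its tangent at \<open>u\<close>. The integrands \<open>W\<close> and \<open>F\<close> lie above their tangents pointwise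
  (\<open>convex_fun_on_above_tangent\<close>). The functional \<open>\<Phi>\<close> of the push-forward lies above its tangent in
  the sense of measures, \<open>\<Phi>(w#L) \<ge> \<Phi>(u#L) + \<integral>\<omega>(w) - \<integral>\<omega>(u)\<close> (\<open>measure_subdifferentialD\<close> and
  \<open>integral_push_lebesgue\<close>). The map \<open>w \<mapsto> \<integral>\<omega>(w)\<close> is in general not linear, but as \<open>\<omega>\<close> extends to a convex
  function it lies above its own tangent \<open>\<integral>\<omega>(u) + \<xi>(u) \<bullet> (w - u)\<close>. Summing up, \<open>E(w) - E(u)\<close> is at
  least the integral of three nonnegative deficits plus the Euler--Lagrange integrand tested with
  \<open>v = w - u\<close>, and the latter integrates to zero.

  For this, \<open>v\<close> must be an admissible test field whose weak gradient is the difference of the weak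
  gradients (\<open>sobolev_bdry_diff\<close>), which rests on the uniqueness of weak gradients and thus on the
  fundamental lemma of the calculus of variations. All integrals must be finite, which rests on
  the measurability of superpositions \<open>x \<mapsto> f x (w x)\<close> with Caratheodory functions
  (\<open>caratheodory_superposition_measurable\<close>).

  Uniqueness: if \<open>E(w) = E(u)\<close>, then the three deficits vanish almost everywhere, and a strictly convex
  function touches its tangent once only. If \<open>\<omega>\<close> or \<open>F\<close> is strictly convex, this gives \<open>w = u\<close>. If \<open>W\<close>
  is, it only gives that \<open>v\<close> has vanishing gradient, and it remains to see that a Sobolev function with
  zero gradient and zero trace vanishes (\<open>sobolev_zero_vanishes_if_gradient_vanishes\<close>). For smooth
  functions, moving from \<open>x\<close> in a fixed coordinate direction until the boundary is hit bounds the value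
  at \<open>x\<close> by the value at the exit point plus the integral of the gradient along the segment. Integrating
  over \<open>x\<close> gives a Friedrichs inequality (\<open>friedrichs_inequality_L1\<close>), in which the boundary term is
  estimated by comparing Lebesgue measure, pushed forward along exit points, with the Hausdorff measure
  (\<open>nn_integral_exit_point_le\<close>).
\<close>

section \<open>The fundamental lemma of the calculus of variations\<close>

lemma has_C1_gradient_continuous: "has_C1_gradient f f' \<Longrightarrow> continuous_on UNIV f"
  unfolding has_C1_gradient_def gderiv_def
  by (meson continuous_at_imp_continuous_on has_derivative_continuous)

lemma has_C1_gradient_mult:
  assumes "has_C1_gradient f f'" "has_C1_gradient h h'"
  shows "has_C1_gradient (\<lambda>x. f x * h x) (\<lambda>x. f x *\<^sub>R h' x + h x *\<^sub>R f' x)"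
  using assms has_C1_gradient_continuous[OF assms(1)] has_C1_gradient_continuous[OF assms(2)]
  unfolding has_C1_gradient_def by (auto intro!: GDERIV_mult continuous_intros)

lemma has_C1_gradient_compose:
  assumes "has_C1_gradient f f'" and r: "\<And>t. (r has_real_derivative r' t) (at t)" "continuous_on UNIV r'"
  shows "has_C1_gradient (\<lambda>x. r (f x)) (\<lambda>x. r' (f x) *\<^sub>R f' x)"
  using assms has_C1_gradient_continuous[OF assms(1)]
  unfolding has_C1_gradient_def
  by (auto intro!: GDERIV_DERIV_compose[where g = r] continuous_intros continuous_on_compose2[OF r(2)] simp del: gderiv_deriv)

lemma has_C1_gradient_prod:
  assumes "finite A" "\<And>j. j \<in> A \<Longrightarrow> \<exists>f'. has_C1_gradient (f j) f'"
  shows "\<exists>f'. has_C1_gradient (\<lambda>x. \<Prod>j\<in>A. f j x) f'"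
  using assms
proof (induction A rule: finite_induct)
  case empty
  then show ?case by (auto simp: has_C1_gradient_def intro!: exI[of _ "\<lambda>_. 0"] GDERIV_const)
next
  case (insert j A)
  then have "\<exists>f'. has_C1_gradient (f j) f'" "\<exists>h'. has_C1_gradient (\<lambda>x. \<Prod>j\<in>A. f j x) h'" by blast+
  then obtain f' h' where "has_C1_gradient (f j) f'" "has_C1_gradient (\<lambda>x. \<Prod>j\<in>A. f j x) h'" by blast
  from has_C1_gradient_mult[OF this] insert show ?case by auto
qed

lemma has_C1_gradient_component: "has_C1_gradient (\<lambda>x. x $ j) (\<lambda>_. axis j 1)"
proof -
  have "((\<lambda>h. h $ j) has_derivative (\<lambda>h. h $ j)) (at x)" for x :: "real ^ 'a"
    by (rule bounded_linear_imp_has_derivative) (rule bounded_linear_vec_nth)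
  then show ?thesis
    by (simp add: has_C1_gradient_def gderiv_def inner_axis)
qed

text \<open>The square of the positive part is \<open>C\<^sup>1\<close> and vanishes exactly on a half-line; products of such
  functions of the coordinates give a bump function of a box.\<close>

lemma has_real_derivative_square_pos_part:
  "((\<lambda>t. (max 0 t)\<^sup>2) has_real_derivative 2 * max 0 t) (at t)"
proof -
  consider "t > 0" | "t < 0" | "t = 0" by linarith
  then show ?thesis
  proof cases
    case 1
    have "((\<lambda>t. t\<^sup>2) has_real_derivative 2 * max 0 t) (at t)"
      using 1 by (auto intro!: derivative_eq_intros)
    then show ?thesis
      by (rule has_field_derivative_transform_within_open[where S = "{0<..}"]) (use 1 in auto)
  next
    case 2
    have "((\<lambda>t. 0) has_real_derivative 2 * max 0 t) (at t)"
      using 2 by (auto intro!: derivative_eq_intros)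
    then show ?thesis
      by (rule has_field_derivative_transform_within_open[where S = "{..<0}"]) (use 2 in auto)
  next
    case 3
    have "((\<lambda>t. max 0 t * (max 0 t / t)) \<longlongrightarrow> 0) (at (0::real))"
    proof (rule Lim_null_comparison)
      show "\<forall>\<^sub>F t in at (0::real). norm (max 0 t * (max 0 t / t)) \<le> \<bar>t\<bar>"
        by (auto simp: eventually_at_filter max_def)
      show "((\<lambda>t::real. \<bar>t\<bar>) \<longlongrightarrow> 0) (at 0)"
        by (auto intro!: tendsto_eq_intros)
    qed
    then show ?thesis
      by (simp add: 3 has_field_derivative_iff power2_eq_square)
  qed
qed

lemma exists_C1_bump_box:
  fixes a b :: "real ^ 'd"
  shows "\<exists>\<psi> \<psi>'. has_C1_gradient \<psi> \<psi>' \<and> (\<forall>x. 0 \<le> \<psi> x) \<and> (\<forall>x. \<psi> x \<noteq> 0 \<longleftrightarrow> x \<in> box a b)"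
proof -
  define s :: "real \<Rightarrow> real" where "s t = (max 0 t)\<^sup>2" for t
  have s: "(s has_real_derivative 2 * max 0 t) (at t)" for t
    unfolding s_def by (rule has_real_derivative_square_pos_part)
  define f :: "'d \<Rightarrow> real ^ 'd \<Rightarrow> real" where "f j x = s (x $ j - a $ j) * s (b $ j - x $ j)" for j x
  have "\<exists>f'. has_C1_gradient (f j) f'" for j
  proof -
    have "((\<lambda>t. s (t - a $ j)) has_real_derivative 2 * max 0 (t - a $ j)) (at t)" for t
    proof -
      have "((\<lambda>t. t - a $ j) has_real_derivative 1) (at t)"
        by (auto intro!: derivative_eq_intros)
      from DERIV_chain2[OF s this] show ?thesis by simp
    qed
    moreover have "continuous_on UNIV (\<lambda>t. 2 * max 0 (t - a $ j))"
      by (intro continuous_intros)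
    ultimately have 1: "has_C1_gradient (\<lambda>x. s (x $ j - a $ j)) (\<lambda>x. (2 * max 0 (x $ j - a $ j)) *\<^sub>R axis j 1)"
      by (rule has_C1_gradient_compose[OF has_C1_gradient_component[of j]])
    have "((\<lambda>t. s (b $ j - t)) has_real_derivative - 2 * max 0 (b $ j - t)) (at t)" for t
    proof -
      have "((\<lambda>t. b $ j - t) has_real_derivative - 1) (at t)"
        by (auto intro!: derivative_eq_intros)
      from DERIV_chain2[OF s this] show ?thesis by simp
    qed
    moreover have "continuous_on UNIV (\<lambda>t. - 2 * max 0 (b $ j - t))"
      by (intro continuous_intros)
    ultimately have 2: "has_C1_gradient (\<lambda>x. s (b $ j - x $ j)) (\<lambda>x. (- 2 * max 0 (b $ j - x $ j)) *\<^sub>R axis j 1)"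
      by (rule has_C1_gradient_compose[OF has_C1_gradient_component[of j]])
    show ?thesis
      using has_C1_gradient_mult[OF 1 2] unfolding f_def by blast
  qed
  then obtain \<psi>' where "has_C1_gradient (\<lambda>x. \<Prod>j\<in>UNIV. f j x) \<psi>'"
    using has_C1_gradient_prod[of UNIV f] by auto
  moreover have "f j x \<ge> 0" for j x by (simp add: f_def s_def)
  moreover have "f j x \<noteq> 0 \<longleftrightarrow> a $ j < x $ j \<and> x $ j < b $ j" for j x
    by (auto simp: f_def s_def max_def)
  ultimately show ?thesis
    by (intro exI[of _ "\<lambda>x. \<Prod>j\<in>UNIV. f j x"] exI[of _ \<psi>']) (auto simp: mem_box_cart intro: prod_nonneg)
qed

text \<open>A bump \<open>\<psi>\<close> of the box is turned into the test functions \<open>1 - 1 / (1 + n \<psi>\<^sup>2)\<close>. They stay between \<open>0\<close>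
  and \<open>1\<close> and converge pointwise to the indicator of the box, so dominated convergence applies.
  Taking \<open>\<psi>\<^sup>2\<close> makes the denominator positive on the whole line, which keeps the composition \<open>C\<^sup>1\<close>
  without a domain restriction.\<close>

lemma integral_box_eq_0_if_orthogonal_to_tests:
  fixes f :: "real ^ 'd \<Rightarrow> real"
  assumes int: "set_integrable lebesgue (cbox a b) f"
    and orth: "\<And>\<phi> \<phi>'. has_C1_gradient \<phi> \<phi>' \<Longrightarrow> compact (closure {x. \<phi> x \<noteq> 0}) \<Longrightarrow> closure {x. \<phi> x \<noteq> 0} \<subseteq> cbox a b
      \<Longrightarrow> (LINT x|lebesgue. f x * \<phi> x) = 0"
  shows "(LINT x:box a b|lebesgue. f x) = 0"
proof -
  obtain \<psi> \<psi>' where \<psi>: "has_C1_gradient \<psi> \<psi>'" and \<psi>0: "\<And>x. 0 \<le> \<psi> x" and \<psi>box: "\<And>x. \<psi> x \<noteq> 0 \<longleftrightarrow> x \<in> box a b"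
    using exists_C1_bump_box by metis
  define r :: "nat \<Rightarrow> real \<Rightarrow> real" where "r n t = 1 - 1 / (1 + real n * t\<^sup>2)" for n t
  have pos: "1 + real n * t\<^sup>2 > 0" for n t by (simp add: add_pos_nonneg)
  have r: "(r n has_real_derivative (real n * (2 * t)) / (1 + real n * t\<^sup>2)\<^sup>2) (at t)" for n t
    unfolding r_def using pos[of n t] by (auto intro!: derivative_eq_intros simp: power2_eq_square)
  have rcont: "continuous_on UNIV (\<lambda>t. (real n * (2 * t)) / (1 + real n * t\<^sup>2)\<^sup>2)" for n
    using pos by (intro continuous_intros) (auto simp: less_imp_neq[THEN not_sym])
  define \<phi> where "\<phi> n x = r n (\<psi> x)" for n x
  have \<phi>_C1: "\<exists>\<phi>'. has_C1_gradient (\<phi> n) \<phi>'" for n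
    using has_C1_gradient_compose[OF \<psi> r rcont] unfolding \<phi>_def by blast
  have \<phi>_out: "\<phi> n x = 0" if "x \<notin> box a b" for n x
    using that \<psi>box[of x] by (auto simp: \<phi>_def r_def)
  have \<phi>_bd: "0 \<le> \<phi> n x \<and> \<phi> n x \<le> 1" for n x
    using pos[of n "\<psi> x"] by (auto simp: \<phi>_def r_def divide_simps)
  have supp: "closure {x. \<phi> n x \<noteq> 0} \<subseteq> cbox a b" for n
    using \<phi>_out box_subset_cbox[of a b] by (intro closure_minimal closed_cbox) blast
  have supp_compact: "compact (closure {x. \<phi> n x \<noteq> 0})" for n
    using compact_Int_closed[OF compact_cbox, of "closure {x. \<phi> n x \<noteq> 0}" a b] supp[of n] by (simp add: Int_absorb1)
  have eq0: "(LINT x|lebesgue. f x * \<phi> n x) = 0" for n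
  proof -
    obtain \<phi>' where "has_C1_gradient (\<phi> n) \<phi>'" using \<phi>_C1 by blast
    from orth[OF this supp_compact supp] show ?thesis .
  qed
  have cbox_f: "integrable lebesgue (\<lambda>x. indicator (cbox a b) x * f x)"
    using int by (simp add: set_integrable_def)
  have \<phi>_meas: "\<phi> n \<in> borel_measurable lebesgue" for n
  proof -
    obtain \<phi>' where "has_C1_gradient (\<phi> n) \<phi>'" using \<phi>_C1 by blast
    from has_C1_gradient_continuous[OF this] show ?thesis
      by (intro measurable_completion) (simp add: borel_measurable_continuous_onI)
  qed
  have split: "f x * \<phi> n x = (indicator (cbox a b) x * f x) * \<phi> n x" for n x
    using \<phi>_out[of x n] box_subset_cbox[of a b] by (auto simp: indicator_def)
  have "(\<lambda>n. LINT x|lebesgue. f x * \<phi> n x) \<longlonglongrightarrow> (LINT x|lebesgue. indicator (box a b) x *\<^sub>R f x)"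
  proof (rule integral_dominated_convergence)
    show "integrable lebesgue (\<lambda>x. norm (indicator (cbox a b) x * f x))"
      using cbox_f by (rule integrable_norm)
    have cbox_f_meas: "(\<lambda>x. indicator (cbox a b) x * f x) \<in> borel_measurable lebesgue"
      using cbox_f by (rule borel_measurable_integrable)
    show "(\<lambda>x. f x * \<phi> n x) \<in> borel_measurable lebesgue" for n
      unfolding split by (rule borel_measurable_times[OF cbox_f_meas \<phi>_meas])
    have "(\<lambda>x. indicator (box a b) x *\<^sub>R f x) = (\<lambda>x. indicator (box a b) x * (indicator (cbox a b) x * f x))"
      using box_subset_cbox[of a b] by (auto simp: indicator_def fun_eq_iff)
    moreover have "\<dots> \<in> borel_measurable lebesgue"
      by (rule borel_measurable_times[OF _ cbox_f_meas]) (simp add: borel_measurable_indicator)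
    ultimately show "(\<lambda>x. indicator (box a b) x *\<^sub>R f x) \<in> borel_measurable lebesgue" by simp
    show "AE x in lebesgue. norm (f x * \<phi> n x) \<le> norm (indicator (cbox a b) x * f x)" for n
      unfolding split using \<phi>_bd by (auto simp: abs_mult intro!: mult_left_le)
    show "AE x in lebesgue. (\<lambda>n. f x * \<phi> n x) \<longlonglongrightarrow> indicator (box a b) x *\<^sub>R f x"
    proof (intro always_eventually allI)
      fix x
      show "(\<lambda>n. f x * \<phi> n x) \<longlonglongrightarrow> indicator (box a b) x *\<^sub>R f x"
      proof (cases "x \<in> box a b")
        case True
        then have "\<psi> x > 0" using \<psi>0[of x] \<psi>box[of x] by linarith
        then have "filterlim (\<lambda>n. 1 + real n * (\<psi> x)\<^sup>2) at_top sequentially"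
            by (intro filterlim_tendsto_add_at_top[OF tendsto_const] filterlim_at_top_mult_tendsto_pos[OF tendsto_const]
                filterlim_real_sequentially) auto
          then have "(\<lambda>n. 1 / (1 + real n * (\<psi> x)\<^sup>2)) \<longlonglongrightarrow> 0"
            by (intro tendsto_divide_0[OF tendsto_const] filterlim_at_top_imp_at_infinity)
          from tendsto_diff[OF tendsto_const[of 1] this] have "(\<lambda>n. r n (\<psi> x)) \<longlonglongrightarrow> 1"
            by (simp add: r_def)
        from tendsto_mult_left[OF this, of "f x"] show ?thesis using True by (simp add: \<phi>_def)
      qed (simp add: \<phi>_out)
    qed
  qed
  then show ?thesis
    using eq0 by (simp add: set_lebesgue_integral_def LIMSEQ_const_iff)
qed

text \<open>Boxes form an intersection-stable generator of the Borel sets, and the sets over which \<open>h\<close>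
  integrates to zero are closed under complements and disjoint unions.\<close>

lemma AE_eq_0_if_integral_boxes_eq_0:
  fixes h :: "'a::euclidean_space \<Rightarrow> real"
  assumes h: "integrable lborel h" and h0: "(LINT x|lborel. h x) = 0"
    and box: "\<And>a b. (LINT x:box a b|lborel. h x) = 0"
  shows "AE x in lborel. h x = 0"
proof -
  let ?G = "range (\<lambda>(a, b). box a b :: 'a set)"
  have "(LINT x:A|lborel. h x) = 0" if "A \<in> sets borel" for A
  proof -
    have si: "set_integrable lborel A h" if "A \<in> sets borel" for A
      using h that unfolding set_integrable_def by (intro integrable_mult_indicator) auto
    have gen: "sigma_sets UNIV ?G = sets borel"
      by (subst borel_eq_box) (rule sets_measure_of[symmetric], auto)
    have "Int_stable ?G"
      by (auto simp: Int_stable_def box_Int_box)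
    moreover have "?G \<subseteq> Pow UNIV" by simp
    moreover have "A \<in> sigma_sets UNIV ?G" using that gen by simp
    ultimately show ?thesis
    proof (induction rule: sigma_sets_induct_disjoint)
      case (basic A)
      then show ?case using box by auto
    next
      case empty
      show ?case by (simp add: set_lebesgue_integral_def)
    next
      case (compl A)
      then have "A \<in> sets borel" by (simp add: gen)
      have "(LINT x:A \<union> (UNIV - A)|lborel. h x) = (LINT x:A|lborel. h x) + (LINT x:UNIV - A|lborel. h x)"
        using \<open>A \<in> sets borel\<close> by (intro set_integral_Un si) auto
      moreover have "A \<union> (UNIV - A) = UNIV" by auto
      ultimately show ?case using compl h0 by (simp add: set_lebesgue_integral_def)
    next
      case (union A)
      then have "A i \<in> sets borel" for i by (auto simp: gen)
      then have "(LINT x:(\<Union>i. A i)|lborel. h x) = (\<Sum>i. (LINT x:(A i)|lborel. h x))"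
        using union(1) by (intro lebesgue_integral_countable_add si) (auto simp: disjoint_family_on_def)
      then show ?case using union by simp
    qed
  qed
  then show ?thesis
    using density_unique_real[OF h, of "\<lambda>_. 0"] by simp
qed

text \<open>The statement is local: \<open>\<Omega>\<close> is a countable union of closed boxes, and on each of them the
  integrals over all smaller boxes vanish.\<close>

theorem fundamental_lemma_calculus_of_variations:
  fixes f :: "real ^ 'd \<Rightarrow> real"
  assumes "open \<Omega>" and loc: "locally_integrable \<Omega> f"
    and orth: "\<And>\<phi> \<phi>'. has_C1_gradient \<phi> \<phi>' \<Longrightarrow> compact (closure {x. \<phi> x \<noteq> 0}) \<Longrightarrow> closure {x. \<phi> x \<noteq> 0} \<subseteq> \<Omega>
      \<Longrightarrow> (LINT x|lebesgue. f x * \<phi> x) = 0"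
  shows "AE x in lebesgue_on \<Omega>. f x = 0"
proof -
  have box0: "(LINT x:box a b|lebesgue. f x) = 0" if "cbox a b \<subseteq> \<Omega>" for a b
    using loc that orth unfolding locally_integrable_def
    by (intro integral_box_eq_0_if_orthogonal_to_tests) (auto dest: order_trans)
  have cbox: "AE x in lebesgue. x \<in> cbox a b \<longrightarrow> f x = 0" if ab: "cbox a b \<subseteq> \<Omega>" for a b
  proof -
    have "integrable lebesgue (\<lambda>x. indicator (cbox a b) x * f x)"
      using loc ab by (auto simp: locally_integrable_def set_integrable_def)
    then have "integrable lebesgue (\<lambda>x. indicator (box a b) x * (indicator (cbox a b) x * f x))"
      using integrable_mult_indicator[of "box a b" lebesgue "\<lambda>x. indicator (cbox a b) x * f x"] by simp
    moreover have "(\<lambda>x. indicator (box a b) x * (indicator (cbox a b) x * f x)) = (\<lambda>x. indicator (box a b) x * f x)"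
      using box_subset_cbox[of a b] by (auto simp: indicator_def fun_eq_iff)
    ultimately have f1: "integrable lebesgue (\<lambda>x. indicator (box a b) x * f x)" by simp
    \<comment> \<open>The generator argument lives on Borel sets, so the Lebesgue measurable function is replaced by a Borel version.\<close>
    then obtain h where h: "h \<in> borel_measurable lborel" "AE x in lborel. indicator (box a b) x * f x = h x"
      using completion_ex_borel_measurable_real[of "\<lambda>x. indicator (box a b) x * f x" lborel] by auto
    have hl: "AE x in lebesgue. indicator (box a b) x * f x = h x"
      using h(2) by (rule AE_completion)
    have transfer: "(LINT x:A|lborel. h x) = (LINT x:A \<inter> box a b|lebesgue. f x)" if "A \<in> sets borel" for A
    proof -
      have "(LINT x:A|lborel. h x) = (LINT x:A|lebesgue. h x)"
        using h(1) that unfolding set_lebesgue_integral_def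
        by (subst integral_completion) auto
      also have "\<dots> = (LINT x|lebesgue. indicator A x * (indicator (box a b) x * f x))"
        unfolding set_lebesgue_integral_def
      proof (rule integral_cong_AE)
        have "h \<in> borel_measurable lebesgue" using h(1) by (intro measurable_completion)
        then show "(\<lambda>x. indicator A x *\<^sub>R h x) \<in> borel_measurable lebesgue"
          using that by (intro borel_measurable_scaleR borel_measurable_indicator) auto
        have "(\<lambda>x. indicator A x * (indicator (box a b) x * f x)) \<in> borel_measurable lebesgue"
          using that by (intro borel_measurable_times[OF _ borel_measurable_integrable[OF f1]] borel_measurable_indicator) auto
        then show "(\<lambda>x. indicator A x * (indicator (box a b) x * f x)) \<in> borel_measurable lebesgue" .
        show "AE x in lebesgue. indicator A x *\<^sub>R h x = indicator A x * (indicator (box a b) x * f x)"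
          using hl by eventually_elim simp
      qed
      also have "\<dots> = (LINT x:A \<inter> box a b|lebesgue. f x)"
        unfolding set_lebesgue_integral_def by (simp add: indicator_inter_arith mult.assoc)
      finally show ?thesis .
    qed
    have "integrable lebesgue h"
      using f1 hl h(1) by (subst integrable_cong_AE[where g = "\<lambda>x. indicator (box a b) x * f x"])
        (auto intro: measurable_completion)
    then have hint: "integrable lborel h"
      using h(1) by (simp add: integrable_completion)
    have "AE x in lborel. h x = 0"
    proof (rule AE_eq_0_if_integral_boxes_eq_0[OF hint])
      show "(LINT x|lborel. h x) = 0"
        using transfer[of UNIV] box0[OF ab] by (simp add: set_lebesgue_integral_def)
      fix c d
      obtain a' b' where *: "box c d \<inter> box a b = box a' b'" by (auto simp: box_Int_box)
      show "(LINT x:box c d|lborel. h x) = 0"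
      proof (cases "box a' b' = {}")
        case True
        then show ?thesis using transfer[of "box c d"] * by (simp add: set_lebesgue_integral_def)
      next
        case False
        have "box a' b' \<subseteq> cbox a b" using * box_subset_cbox[of a b] by blast
        then have "cbox a' b' \<subseteq> cbox a b" using False by (metis closed_cbox closure_box closure_minimal)
        then show ?thesis using transfer[of "box c d"] * box0[of a' b'] ab by auto
      qed
    qed
    then have "AE x in lebesgue. h x = 0" by (rule AE_completion)
    moreover have "AE x in lebesgue. x \<notin> cbox a b - box a b"
      using negligible_frontier_interval[of a b] by (intro AE_not_in) (simp add: negligible_iff_null_sets)
    ultimately show ?thesis using hl
      by eventually_elim (auto simp: indicator_def split: if_splits)
  qed
  obtain \<D> where "countable \<D>" and \<D>: "\<And>X. X \<in> \<D> \<Longrightarrow> \<exists>a b. X = cbox a b" "\<Union>\<D> = \<Omega>"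
    using open_countable_Union_open_cbox[OF \<open>open \<Omega>\<close>] by metis
  have "AE x in lebesgue. x \<in> X \<longrightarrow> f x = 0" if "X \<in> \<D>" for X
    using \<D>(1)[OF that] \<D>(2) that cbox by (metis Union_upper)
  then have "AE x in lebesgue. \<forall>X\<in>\<D>. x \<in> X \<longrightarrow> f x = 0"
    by (subst AE_ball_countable[OF \<open>countable \<D>\<close>]) blast
  then have "AE x in lebesgue. x \<in> \<Omega> \<longrightarrow> f x = 0"
    using \<D>(2) by (auto elim!: eventually_mono)
  then show ?thesis
    using \<open>open \<Omega>\<close> by (simp add: AE_restrict_space_iff)
qed

section \<open>Weak gradients and Sobolev functions\<close>

lemma borel_measurable_lebesgue_on_AE:
  fixes f :: "'a::euclidean_space \<Rightarrow> 'b::euclidean_space"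
  assumes f: "f \<in> borel_measurable (lebesgue_on S)" and S: "S \<in> sets lebesgue"
    and eq: "AE x in lebesgue_on S. f x = g x"
  shows "g \<in> borel_measurable (lebesgue_on S)"
proof -
  have "(\<lambda>x. if x \<in> S then g x else 0) \<in> borel_measurable lebesgue"
  proof (rule borel_measurable_AE)
    show "(\<lambda>x. if x \<in> S then f x else 0) \<in> borel_measurable lebesgue"
      using f S by (rule borel_measurable_if_I)
    show "AE x in lebesgue. (if x \<in> S then f x else 0) = (if x \<in> S then g x else 0)"
      using eq S by (auto simp: AE_restrict_space_iff elim: eventually_mono)
  qed
  then show ?thesis by (rule borel_measurable_if_D)
qed

lemma locally_integrable_inner:
  "locally_integrable \<Omega> f \<Longrightarrow> locally_integrable \<Omega> (\<lambda>x. f x \<bullet> c)"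
  unfolding locally_integrable_def set_integrable_def
  using integrable_inner_left[of c lebesgue] by fastforce

lemma locally_integrable_diff:
  "locally_integrable \<Omega> f \<Longrightarrow> locally_integrable \<Omega> h \<Longrightarrow> locally_integrable \<Omega> (\<lambda>x. f x - h x)"
  unfolding locally_integrable_def by (auto intro: set_integral_diff)

lemma locally_integrable_component:
  fixes u :: "real ^ 'd \<Rightarrow> real ^ 'k"
  shows "locally_integrable \<Omega> u \<Longrightarrow> locally_integrable \<Omega> (\<lambda>x. u x $ i)"
  using locally_integrable_inner[of \<Omega> u "axis i 1"] by (simp add: inner_axis)

lemma locally_integrable_entry:
  fixes G :: "real ^ 'd \<Rightarrow> real ^ 'd ^ 'k"
  shows "locally_integrable \<Omega> G \<Longrightarrow> locally_integrable \<Omega> (\<lambda>x. G x $ i $ j)"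
  using locally_integrable_inner[of \<Omega> G "axis i (axis j 1)"] by (simp add: inner_axis)

text \<open>Testing a locally integrable function is legitimate because only its values on the compact support
  matter; there the test function is bounded.\<close>

lemma integrable_locally_integrable_times_test:
  fixes f \<phi> :: "real ^ 'd \<Rightarrow> real"
  assumes f: "locally_integrable \<Omega> f" and K: "compact K" "K \<subseteq> \<Omega>"
    and \<phi>: "continuous_on UNIV \<phi>" "\<And>x. x \<notin> K \<Longrightarrow> \<phi> x = 0" and \<Omega>: "open \<Omega>"
  shows "integrable (lebesgue_on \<Omega>) (\<lambda>x. f x * \<phi> x)"
    and "(LINT x|lebesgue_on \<Omega>. f x * \<phi> x) = (LINT x|lebesgue. f x * \<phi> x)"
proof -
  obtain c where c: "\<And>x. x \<in> K \<Longrightarrow> \<bar>\<phi> x\<bar> \<le> c"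
    using compact_imp_bounded[OF compact_continuous_image[OF continuous_on_subset[OF \<phi>(1)] K(1)]]
    by (auto simp: bounded_iff)
  have fK: "integrable lebesgue (\<lambda>x. indicator K x * f x)"
    using f K by (auto simp: locally_integrable_def set_integrable_def)
  have split: "f x * \<phi> x = (indicator K x * f x) * \<phi> x" for x
    using \<phi>(2)[of x] by (auto simp: indicator_def)
  have "\<phi> \<in> borel_measurable lebesgue"
    by (intro measurable_completion) (simp add: \<phi>(1) borel_measurable_continuous_onI)
  then have meas: "(\<lambda>x. (indicator K x * f x) * \<phi> x) \<in> borel_measurable lebesgue"
    by (rule borel_measurable_times[OF borel_measurable_integrable[OF fK]])
  have "integrable lebesgue (\<lambda>x. f x * \<phi> x)"
    unfolding split
  proof (rule Bochner_Integration.integrable_bound[OF _ meas])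
    show "integrable lebesgue (\<lambda>x. c * (indicator K x * f x))"
      using fK by simp
    have "\<bar>indicator K x * f x * \<phi> x\<bar> \<le> \<bar>c * (indicator K x * f x)\<bar>" for x
    proof (cases "x \<in> K")
      case True
      with c[of x] have "\<bar>\<phi> x\<bar> \<le> \<bar>c\<bar>" by linarith
      with mult_left_mono[OF this, of "\<bar>f x\<bar>"] show ?thesis
        by (simp add: abs_mult indicator_def mult.commute)
    qed simp
    then show "AE x in lebesgue. norm (indicator K x * f x * \<phi> x) \<le> norm (c * (indicator K x * f x))"
      by simp
  qed
  moreover have zero: "\<phi> x = 0" if "x \<notin> \<Omega>" for x
    using that K(2) \<phi>(2) by blast
  have *: "(\<lambda>x. indicator \<Omega> x *\<^sub>R (f x * \<phi> x)) = (\<lambda>x. f x * \<phi> x)"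
    using zero by (auto simp: indicator_def fun_eq_iff)
  ultimately show "integrable (lebesgue_on \<Omega>) (\<lambda>x. f x * \<phi> x)"
    using \<Omega> by (simp add: integrable_restrict_space del: real_scaleR_def)
  show "(LINT x|lebesgue_on \<Omega>. f x * \<phi> x) = (LINT x|lebesgue. f x * \<phi> x)"
    using \<Omega> * by (simp add: integral_restrict_space del: real_scaleR_def)
qed

lemma C1_gradient_vanishes_off_support:
  assumes "has_C1_gradient \<phi> \<phi>'" "x \<notin> closure {x. \<phi> x \<noteq> 0}"
  shows "\<phi>' x = 0"
proof -
  have "(\<phi> has_derivative (\<lambda>h. h \<bullet> \<phi>' x)) (at x)"
    using assms(1) by (simp add: has_C1_gradient_def gderiv_def)
  moreover have "(\<phi> has_derivative (\<lambda>h. 0)) (at x)"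
  proof (rule has_derivative_transform_within_open)
    show "((\<lambda>_. 0) has_derivative (\<lambda>h. 0)) (at x)" by simp
    show "open (- closure {x. \<phi> x \<noteq> 0})" "x \<in> - closure {x. \<phi> x \<noteq> 0}" using assms(2) by auto
    show "0 = \<phi> y" if "y \<in> - closure {x. \<phi> x \<noteq> 0}" for y
      using that closure_subset[of "{x. \<phi> x \<noteq> 0}"] by auto
  qed
  ultimately have "(\<lambda>h. h \<bullet> \<phi>' x) = (\<lambda>h. 0)" by (rule has_derivative_unique)
  then have "\<phi>' x \<bullet> \<phi>' x = 0" by meson
  then show ?thesis by simp
qed

lemma test_function_off_support: "x \<notin> closure {x. \<phi> x \<noteq> 0} \<Longrightarrow> \<phi> x = 0"
  using closure_subset[of "{x. \<phi> x \<noteq> 0}"] by auto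

text \<open>This makes the choice in \<^const>\<open>weak_grad\<close> harmless: every weak gradient agrees with the chosen one
  almost everywhere.\<close>

lemma has_weak_gradient_unique:
  fixes G H :: "real ^ 'd \<Rightarrow> real ^ 'd ^ 'k"
  assumes \<Omega>: "open \<Omega>" and G: "has_weak_gradient \<Omega> u G" and H: "has_weak_gradient \<Omega> u H"
  shows "AE x in lebesgue_on \<Omega>. G x = H x"
proof -
  have "AE x in lebesgue_on \<Omega>. G x $ i $ j - H x $ i $ j = 0" for i j
  proof (rule fundamental_lemma_calculus_of_variations[OF \<Omega>])
    have lG: "locally_integrable \<Omega> (\<lambda>x. G x $ i $ j)" and lH: "locally_integrable \<Omega> (\<lambda>x. H x $ i $ j)"
      using G H by (auto simp: has_weak_gradient_def intro: locally_integrable_entry)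
    then show l: "locally_integrable \<Omega> (\<lambda>x. G x $ i $ j - H x $ i $ j)"
      by (rule locally_integrable_diff)
    fix \<phi> \<phi>' assume \<phi>: "has_C1_gradient \<phi> \<phi>'" "compact (closure {x. \<phi> x \<noteq> 0})" "closure {x. \<phi> x \<noteq> 0} \<subseteq> \<Omega>"
    note test = integrable_locally_integrable_times_test[OF _ \<phi>(2,3) has_C1_gradient_continuous[OF \<phi>(1)]
      test_function_off_support[where \<phi> = \<phi>] \<Omega>]
    have "(LINT x|lebesgue_on \<Omega>. u x $ i * \<phi>' x $ j) = - (LINT x|lebesgue_on \<Omega>. G x $ i $ j * \<phi> x)"
      "(LINT x|lebesgue_on \<Omega>. u x $ i * \<phi>' x $ j) = - (LINT x|lebesgue_on \<Omega>. H x $ i $ j * \<phi> x)"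
      using G H \<phi> unfolding has_weak_gradient_def by blast+
    then have "(LINT x|lebesgue_on \<Omega>. G x $ i $ j * \<phi> x) = (LINT x|lebesgue_on \<Omega>. H x $ i $ j * \<phi> x)"
      by linarith
    then have "(LINT x|lebesgue_on \<Omega>. G x $ i $ j * \<phi> x - H x $ i $ j * \<phi> x) = 0"
      using test(1)[OF lG] test(1)[OF lH] by simp
    then show "(LINT x|lebesgue. (G x $ i $ j - H x $ i $ j) * \<phi> x) = 0"
      using test(2)[OF l] by (simp add: left_diff_distrib)
  qed
  then have "AE x in lebesgue_on \<Omega>. \<forall>i\<in>UNIV. \<forall>j\<in>UNIV. G x $ i $ j - H x $ i $ j = 0"
    by (intro AE_finite_allI) auto
  then show ?thesis
    by eventually_elim (simp add: vec_eq_iff)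
qed

lemma has_weak_gradient_diff:
  fixes u w :: "real ^ 'd \<Rightarrow> real ^ 'k"
  assumes \<Omega>: "open \<Omega>" and G: "has_weak_gradient \<Omega> w G" and H: "has_weak_gradient \<Omega> u H"
  shows "has_weak_gradient \<Omega> (\<lambda>x. w x - u x) (\<lambda>x. G x - H x)"
  unfolding has_weak_gradient_def
proof (intro conjI allI impI)
  show "locally_integrable \<Omega> (\<lambda>x. w x - u x)" "locally_integrable \<Omega> (\<lambda>x. G x - H x)"
    using G H by (auto simp: has_weak_gradient_def intro: locally_integrable_diff)
  fix \<phi> \<phi>' i j
  assume \<phi>: "has_C1_gradient \<phi> \<phi>'" "compact (closure {x. \<phi> x \<noteq> 0})" "closure {x. \<phi> x \<noteq> 0} \<subseteq> \<Omega>"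
  have lG: "locally_integrable \<Omega> (\<lambda>x. G x $ i $ j)" and lH: "locally_integrable \<Omega> (\<lambda>x. H x $ i $ j)"
    and lw: "locally_integrable \<Omega> (\<lambda>x. w x $ i)" and lu: "locally_integrable \<Omega> (\<lambda>x. u x $ i)"
    using G H by (auto simp: has_weak_gradient_def intro: locally_integrable_entry locally_integrable_component)
  note test = integrable_locally_integrable_times_test(1)[OF _ \<phi>(2,3) has_C1_gradient_continuous[OF \<phi>(1)]
      test_function_off_support[where \<phi> = \<phi>] \<Omega>]
  have "continuous_on UNIV (\<lambda>x. \<phi>' x $ j)"
    using \<phi>(1) by (auto simp: has_C1_gradient_def intro: continuous_intros)
  note test' = integrable_locally_integrable_times_test(1)[OF _ \<phi>(2,3) this _ \<Omega>]
  have off: "\<phi>' x $ j = 0" if "x \<notin> closure {x. \<phi> x \<noteq> 0}" for x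
    using C1_gradient_vanishes_off_support[OF \<phi>(1) that] by simp
  have "(LINT x|lebesgue_on \<Omega>. w x $ i * \<phi>' x $ j) = - (LINT x|lebesgue_on \<Omega>. G x $ i $ j * \<phi> x)"
    "(LINT x|lebesgue_on \<Omega>. u x $ i * \<phi>' x $ j) = - (LINT x|lebesgue_on \<Omega>. H x $ i $ j * \<phi> x)"
    using G H \<phi> unfolding has_weak_gradient_def by blast+
  then show "(LINT x|lebesgue_on \<Omega>. (w x - u x) $ i * \<phi>' x $ j) = - (LINT x|lebesgue_on \<Omega>. (G x - H x) $ i $ j * \<phi> x)"
    using test[OF lG] test[OF lH] test'[OF lw off] test'[OF lu off] by (simp add: left_diff_distrib)
qed

lemma norm_diff_powr_le:
  fixes a b :: "'a::real_normed_vector"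
  assumes "p \<ge> 0"
  shows "norm (a - b) powr p \<le> 2 powr p * (norm a powr p + norm b powr p)"
proof -
  let ?m = "max (norm a) (norm b)"
  have "norm (a - b) \<le> 2 * ?m" using norm_triangle_ineq4[of a b] by linarith
  then have "norm (a - b) powr p \<le> (2 * ?m) powr p" using assms by (intro powr_mono2) auto
  also have "\<dots> = 2 powr p * ?m powr p" by (rule powr_mult)
  also have "?m powr p \<le> norm a powr p + norm b powr p" by (auto simp: max_def)
  finally show ?thesis by simp
qed

lemma Lp_fun_diff:
  assumes "Lp_fun M p f" "Lp_fun M p h" "p \<ge> 0"
  shows "Lp_fun M p (\<lambda>x. f x - h x)"
  unfolding Lp_fun_def
proof
  have [measurable]: "f \<in> borel_measurable M" "h \<in> borel_measurable M"
    using assms by (auto simp: Lp_fun_def)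
  show "(\<lambda>x. f x - h x) \<in> borel_measurable M" by measurable
  show "integrable M (\<lambda>x. norm (f x - h x) powr p)"
  proof (rule Bochner_Integration.integrable_bound)
    show "integrable M (\<lambda>x. 2 powr p * (norm (f x) powr p + norm (h x) powr p))"
      using assms by (auto simp: Lp_fun_def)
    show "AE x in M. norm (norm (f x - h x) powr p) \<le> norm (2 powr p * (norm (f x) powr p + norm (h x) powr p))"
      using norm_diff_powr_le[OF assms(3)] by (auto intro!: AE_I2 order_trans[OF _ abs_ge_self])
  qed measurable
qed

lemma Lp_tendsto_diff:
  assumes meas: "\<And>n. f n \<in> borel_measurable M" "g \<in> borel_measurable M" "\<And>n. f' n \<in> borel_measurable M" "g' \<in> borel_measurable M"
    and lim: "Lp_tendsto M p f g" "Lp_tendsto M p f' g'" and "p \<ge> 0"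
  shows "Lp_tendsto M p (\<lambda>n x. f n x - f' n x) (\<lambda>x. g x - g' x)"
  unfolding Lp_tendsto_def
proof (rule tendsto_sandwich[OF _ _ tendsto_const])
  note meas[measurable]
  let ?I = "\<lambda>n. \<integral>\<^sup>+x. ennreal (norm (f n x - g x) powr p) \<partial>M" and ?I' = "\<lambda>n. \<integral>\<^sup>+x. ennreal (norm (f' n x - g' x) powr p) \<partial>M"
  show "\<forall>\<^sub>F n in sequentially. (\<integral>\<^sup>+x. ennreal (norm (f n x - f' n x - (g x - g' x)) powr p) \<partial>M)
      \<le> ennreal (2 powr p) * (?I n + ?I' n)"
  proof (intro always_eventually allI)
    fix n
    have "(\<integral>\<^sup>+x. ennreal (norm (f n x - f' n x - (g x - g' x)) powr p) \<partial>M)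
      \<le> (\<integral>\<^sup>+x. ennreal (2 powr p) * (ennreal (norm (f n x - g x) powr p) + ennreal (norm (f' n x - g' x) powr p)) \<partial>M)"
    proof (intro nn_integral_mono)
      fix x
      have "f n x - f' n x - (g x - g' x) = (f n x - g x) - (f' n x - g' x)" by simp
      then have "norm (f n x - f' n x - (g x - g' x)) powr p \<le> 2 powr p * (norm (f n x - g x) powr p + norm (f' n x - g' x) powr p)"
        using norm_diff_powr_le[OF \<open>p \<ge> 0\<close>, of "f n x - g x" "f' n x - g' x"] by metis
      then show "ennreal (norm (f n x - f' n x - (g x - g' x)) powr p)
          \<le> ennreal (2 powr p) * (ennreal (norm (f n x - g x) powr p) + ennreal (norm (f' n x - g' x) powr p))"
        by (simp add: ennreal_mult[symmetric] ennreal_plus[symmetric] ennreal_leI del: ennreal_plus)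
    qed
    also have "\<dots> = ennreal (2 powr p) * (?I n + ?I' n)"
      by (subst nn_integral_cmult) (auto intro!: arg_cong2[where f = "(*)"] nn_integral_add)
    finally show "(\<integral>\<^sup>+x. ennreal (norm (f n x - f' n x - (g x - g' x)) powr p) \<partial>M) \<le> \<dots>" .
  qed
  have "(\<lambda>n. ennreal (2 powr p) * (?I n + ?I' n)) \<longlonglongrightarrow> ennreal (2 powr p) * (0 + 0)"
    using lim unfolding Lp_tendsto_def by (intro ennreal_tendsto_cmult tendsto_add) auto
  then show "(\<lambda>n. ennreal (2 powr p) * (?I n + ?I' n)) \<longlonglongrightarrow> 0" by simp
qed auto

lemma Lp_tendsto_cong_AE:
  assumes "Lp_tendsto M p f g" "AE x in M. g x = h x"
  shows "Lp_tendsto M p f h"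
proof -
  have "(\<integral>\<^sup>+x. ennreal (norm (f n x - g x) powr p) \<partial>M) = (\<integral>\<^sup>+x. ennreal (norm (f n x - h x) powr p) \<partial>M)" for n
    using assms(2) by (intro nn_integral_cong_AE) (auto elim: eventually_mono)
  then show ?thesis using assms(1) by (simp add: Lp_tendsto_def)
qed

text \<open>Membership in the Sobolev space only asserts that some weak gradient is \<open>p\<close>-integrable; by
  uniqueness the chosen one inherits this, using that Lebesgue measure is complete.\<close>

lemma weak_grad_sobolev:
  fixes u :: "real ^ 'd \<Rightarrow> real ^ 'k"
  assumes "open \<Omega>" "u \<in> sobolev \<Omega> p"
  shows "has_weak_gradient \<Omega> u (weak_grad \<Omega> u)" "Lp_fun (lebesgue_on \<Omega>) p (weak_grad \<Omega> u)"
proof -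
  obtain G where G: "has_weak_gradient \<Omega> u G" "Lp_fun (lebesgue_on \<Omega>) p G"
    using assms(2) by (auto simp: sobolev_def)
  show w: "has_weak_gradient \<Omega> u (weak_grad \<Omega> u)"
    unfolding weak_grad_def by (rule someI[of "has_weak_gradient \<Omega> u", OF G(1)])
  have eq: "AE x in lebesgue_on \<Omega>. G x = weak_grad \<Omega> u x"
    by (rule has_weak_gradient_unique[OF assms(1) G(1) w])
  have meas: "weak_grad \<Omega> u \<in> borel_measurable (lebesgue_on \<Omega>)"
    using G assms by (intro borel_measurable_lebesgue_on_AE[OF _ _ eq]) (auto simp: Lp_fun_def)
  moreover have "integrable (lebesgue_on \<Omega>) (\<lambda>x. norm (weak_grad \<Omega> u x) powr p)"
  proof (rule integrable_cong_AE_imp)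
    show "integrable (lebesgue_on \<Omega>) (\<lambda>x. norm (G x) powr p)" using G(2) by (simp add: Lp_fun_def)
    show "AE x in lebesgue_on \<Omega>. norm (G x) powr p = norm (weak_grad \<Omega> u x) powr p"
      using eq by eventually_elim simp
    show "(\<lambda>x. norm (weak_grad \<Omega> u x) powr p) \<in> borel_measurable (lebesgue_on \<Omega>)"
      using meas by measurable
  qed
  ultimately show "Lp_fun (lebesgue_on \<Omega>) p (weak_grad \<Omega> u)" by (simp add: Lp_fun_def)
qed

lemma continuous_measurable_lebesgue_on:
  fixes f :: "'a::euclidean_space \<Rightarrow> 'b::euclidean_space"
  shows "continuous_on UNIV f \<Longrightarrow> f \<in> borel_measurable (lebesgue_on S)"
  by (intro measurable_restrict_space1 measurable_completion) (simp add: borel_measurable_continuous_onI)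

lemma continuous_measurable_surface_measure:
  fixes f :: "real ^ 'd \<Rightarrow> 'b::euclidean_space"
  assumes "continuous_on UNIV f"
  shows "f \<in> borel_measurable (surface_measure \<Omega>)"
proof -
  have "f \<in> borel_measurable (hausdorff_measure (CARD('d) - 1))"
    using borel_measurable_continuous_onI[OF assms] by (simp cong: measurable_cong_sets)
  then show ?thesis
    unfolding surface_measure_def by (intro measurable_restrict_space1 measurable_completion)
qed

lemma has_C1_jacobian_continuous: "has_C1_jacobian \<phi> J \<Longrightarrow> continuous_on UNIV \<phi>"
  unfolding has_C1_jacobian_def
  by (meson continuous_at_imp_continuous_on has_derivative_continuous)

lemma has_C1_jacobian_diff:
  assumes "has_C1_jacobian \<phi> J" "has_C1_jacobian \<psi> K"
  shows "has_C1_jacobian (\<lambda>x. \<phi> x - \<psi> x) (\<lambda>x. J x - K x)"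
proof -
  have "((\<lambda>x. \<phi> x - \<psi> x) has_derivative (\<lambda>h. J x *v h - K x *v h)) (at x)" for x
    using assms by (intro has_derivative_diff) (auto simp: has_C1_jacobian_def)
  then show ?thesis
    using assms by (auto simp: has_C1_jacobian_def matrix_vector_mult_diff_rdistrib intro: continuous_on_diff)
qed

text \<open>Two competitors with the same boundary values differ by an admissible test field of the
  Euler--Lagrange equation. The approximating \<open>C\<^sup>1\<close> sequences of both are subtracted.\<close>

lemma sobolev_bdry_diff:
  fixes u w :: "real ^ 'd \<Rightarrow> real ^ 'k"
  assumes \<Omega>: "open \<Omega>" and p: "p \<ge> 0" and w: "w \<in> sobolev_bdry \<Omega> D p g" and u: "u \<in> sobolev_bdry \<Omega> D p g"
  shows "(\<lambda>x. w x - u x) \<in> sobolev_zero \<Omega> p"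
    and "AE x in lebesgue_on \<Omega>. weak_grad \<Omega> (\<lambda>x. w x - u x) x = weak_grad \<Omega> w x - weak_grad \<Omega> u x"
proof -
  have sw: "w \<in> sobolev \<Omega> p" and su: "u \<in> sobolev \<Omega> p" using w u by (auto simp: sobolev_bdry_def)
  note gw = weak_grad_sobolev[OF \<Omega> sw] and gu = weak_grad_sobolev[OF \<Omega> su]
  have gd: "has_weak_gradient \<Omega> (\<lambda>x. w x - u x) (\<lambda>x. weak_grad \<Omega> w x - weak_grad \<Omega> u x)"
    by (rule has_weak_gradient_diff[OF \<Omega> gw(1) gu(1)])
  have Lpd: "Lp_fun (lebesgue_on \<Omega>) p (\<lambda>x. w x - u x)"
    using sw su p by (auto simp: sobolev_def intro: Lp_fun_diff)
  have sd: "(\<lambda>x. w x - u x) \<in> sobolev \<Omega> p"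
    using Lpd gd Lp_fun_diff[OF gw(2) gu(2) p] by (auto simp: sobolev_def)
  have eq: "AE x in lebesgue_on \<Omega>. weak_grad \<Omega> w x - weak_grad \<Omega> u x = weak_grad \<Omega> (\<lambda>x. w x - u x) x"
    by (rule has_weak_gradient_unique[OF \<Omega> gd weak_grad_sobolev(1)[OF \<Omega> sd]])
  then show "AE x in lebesgue_on \<Omega>. weak_grad \<Omega> (\<lambda>x. w x - u x) x = weak_grad \<Omega> w x - weak_grad \<Omega> u x"
    by eventually_elim simp
  have "has_trace \<Omega> p w g" "has_trace \<Omega> p u g" using w u by (auto simp: sobolev_bdry_def)
  then obtain \<phi> J \<psi> K where g: "g \<in> borel_measurable (surface_measure \<Omega>)"
    and \<phi>: "\<And>n. has_C1_jacobian (\<phi> n) (J n)" "Lp_tendsto (lebesgue_on \<Omega>) p \<phi> w"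
      "Lp_tendsto (lebesgue_on \<Omega>) p J (weak_grad \<Omega> w)" "Lp_tendsto (surface_measure \<Omega>) p \<phi> g"
    and \<psi>: "\<And>n. has_C1_jacobian (\<psi> n) (K n)" "Lp_tendsto (lebesgue_on \<Omega>) p \<psi> u"
      "Lp_tendsto (lebesgue_on \<Omega>) p K (weak_grad \<Omega> u)" "Lp_tendsto (surface_measure \<Omega>) p \<psi> g"
    unfolding has_trace_def by metis
  have c: "continuous_on UNIV (\<phi> n)" "continuous_on UNIV (\<psi> n)" "continuous_on UNIV (J n)" "continuous_on UNIV (K n)" for n
    using \<phi>(1)[of n] \<psi>(1)[of n] by (auto intro: has_C1_jacobian_continuous) (auto simp: has_C1_jacobian_def)
  have m: "w \<in> borel_measurable (lebesgue_on \<Omega>)" "u \<in> borel_measurable (lebesgue_on \<Omega>)"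
     "weak_grad \<Omega> w \<in> borel_measurable (lebesgue_on \<Omega>)" "weak_grad \<Omega> u \<in> borel_measurable (lebesgue_on \<Omega>)"
    using sw su gw gu by (auto simp: sobolev_def Lp_fun_def)
  have "has_trace \<Omega> p (\<lambda>x. w x - u x) (\<lambda>_. 0)"
    unfolding has_trace_def
  proof (intro conjI exI allI)
    show "has_C1_jacobian (\<lambda>x. \<phi> n x - \<psi> n x) (\<lambda>x. J n x - K n x)" for n
      by (rule has_C1_jacobian_diff[OF \<phi>(1) \<psi>(1)])
    show "Lp_tendsto (lebesgue_on \<Omega>) p (\<lambda>n x. \<phi> n x - \<psi> n x) (\<lambda>x. w x - u x)"
      by (intro Lp_tendsto_diff \<phi> \<psi> p m continuous_measurable_lebesgue_on c)
    have "Lp_tendsto (lebesgue_on \<Omega>) p (\<lambda>n x. J n x - K n x) (\<lambda>x. weak_grad \<Omega> w x - weak_grad \<Omega> u x)"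
      by (intro Lp_tendsto_diff \<phi> \<psi> p m continuous_measurable_lebesgue_on c)
    then show "Lp_tendsto (lebesgue_on \<Omega>) p (\<lambda>n x. J n x - K n x) (weak_grad \<Omega> (\<lambda>x. w x - u x))"
      by (rule Lp_tendsto_cong_AE[OF _ eq])
    have "Lp_tendsto (surface_measure \<Omega>) p (\<lambda>n x. \<phi> n x - \<psi> n x) (\<lambda>x. g x - g x)"
      by (intro Lp_tendsto_diff \<phi> \<psi> p g continuous_measurable_surface_measure c)
    then show "Lp_tendsto (surface_measure \<Omega>) p (\<lambda>n x. \<phi> n x - \<psi> n x) (\<lambda>_. 0)" by simp
  qed simp
  then show "(\<lambda>x. w x - u x) \<in> sobolev_zero \<Omega> p"
    using sd by (simp add: sobolev_bdry_def)
qed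

section \<open>Exit points and the surface measure\<close>

text \<open>The half-line from \<open>x\<close> in direction \<open>e\<close> leaves \<open>\<Omega>\<close> for the first time at the exit time. Outside \<open>\<Omega>\<close>
  the exit time is \<open>0\<close> and the exit point is \<open>x\<close> itself, so that both functions are total.\<close>

definition exit_time :: "'a::euclidean_space set \<Rightarrow> 'a \<Rightarrow> 'a \<Rightarrow> real" where
  "exit_time \<Omega> e x = Inf {t. 0 \<le> t \<and> x + t *\<^sub>R e \<notin> \<Omega>}"

definition exit_point :: "'a::euclidean_space set \<Rightarrow> 'a \<Rightarrow> 'a \<Rightarrow> 'a" where
  "exit_point \<Omega> e x = x + exit_time \<Omega> e x *\<^sub>R e"

locale line_exit =
  fixes \<Omega> :: "'a::euclidean_space set" and e :: 'a and R :: real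
  assumes \<Omega>_open: "open \<Omega>" and \<Omega>_bound: "\<And>x. x \<in> \<Omega> \<Longrightarrow> norm x \<le> R" and e_unit: "norm e = 1" and R_pos: "R > 0"
begin

lemma exit_time_props:
  shows "exit_time \<Omega> e x \<ge> 0" and "exit_point \<Omega> e x \<notin> \<Omega>"
    and "\<And>t. 0 \<le> t \<Longrightarrow> t < exit_time \<Omega> e x \<Longrightarrow> x + t *\<^sub>R e \<in> \<Omega>"
proof -
  let ?S = "{t. 0 \<le> t \<and> x + t *\<^sub>R e \<notin> \<Omega>}"
  have "R + norm x + 1 \<in> ?S"
  proof -
    have "R + norm x + 1 - norm x \<le> norm (x + (R + norm x + 1) *\<^sub>R e)"
      using norm_triangle_ineq4[of "x + (R + norm x + 1) *\<^sub>R e" x] e_unit R_pos by simp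
    then show ?thesis using \<Omega>_bound[of "x + (R + norm x + 1) *\<^sub>R e"] R_pos by auto
  qed
  then have ne: "?S \<noteq> {}" by blast
  have bd: "bdd_below ?S" by (rule bdd_belowI[of _ 0]) simp
  have "closed {t. x + t *\<^sub>R e \<in> - \<Omega>}"
  proof -
    have "closed ((\<lambda>t. x + t *\<^sub>R e) -` (- \<Omega>))"
      using \<Omega>_open by (intro continuous_closed_vimage continuous_intros) (auto simp: closed_def)
    then show ?thesis by (simp add: vimage_def)
  qed
  then have "closed ({0..} \<inter> {t. x + t *\<^sub>R e \<in> - \<Omega>})" by (intro closed_Int) auto
  moreover have "{0..} \<inter> {t. x + t *\<^sub>R e \<in> - \<Omega>} = ?S" by auto
  ultimately have "closed ?S" by simp
  from closed_contains_Inf[OF ne bd this]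
  show "exit_time \<Omega> e x \<ge> 0" "exit_point \<Omega> e x \<notin> \<Omega>" by (auto simp: exit_time_def exit_point_def)
  fix t :: real assume "0 \<le> t" "t < exit_time \<Omega> e x"
  then show "x + t *\<^sub>R e \<in> \<Omega>"
    using cInf_lower[OF _ bd, of t] by (auto simp: exit_time_def)
qed

lemma exit_point_in_frontier:
  assumes "x \<in> \<Omega>"
  shows "exit_point \<Omega> e x \<in> frontier \<Omega>"
proof -
  let ?\<tau> = "exit_time \<Omega> e x"
  have "?\<tau> \<noteq> 0" using exit_time_props(2)[of x] assms by (auto simp: exit_point_def)
  then have \<tau>: "?\<tau> > 0" using exit_time_props(1)[of x] by simp
  have "exit_point \<Omega> e x \<in> closure \<Omega>"
    unfolding closure_sequential
  proof (intro exI[of _ "\<lambda>n. x + (?\<tau> - ?\<tau> * inverse (real (Suc n))) *\<^sub>R e"] conjI allI)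
    fix n
    have "inverse (real (Suc n)) \<le> 1" by (simp add: field_simps)
    then have "0 \<le> ?\<tau> - ?\<tau> * inverse (real (Suc n))" using \<tau> by (simp add: mult_left_le)
    moreover have "?\<tau> - ?\<tau> * inverse (real (Suc n)) < ?\<tau>" using \<tau> by simp
    ultimately show "x + (?\<tau> - ?\<tau> * inverse (real (Suc n))) *\<^sub>R e \<in> \<Omega>" by (rule exit_time_props(3))
  next
    have "(\<lambda>n. x + (?\<tau> - ?\<tau> * inverse (real (Suc n))) *\<^sub>R e) \<longlonglongrightarrow> x + (?\<tau> - ?\<tau> * 0) *\<^sub>R e"
      by (intro tendsto_intros LIMSEQ_inverse_real_of_nat)
    then show "(\<lambda>n. x + (?\<tau> - ?\<tau> * inverse (real (Suc n))) *\<^sub>R e) \<longlonglongrightarrow> exit_point \<Omega> e x"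
      by (simp add: exit_point_def)
  qed
  then show ?thesis
    using exit_time_props(2)[of x] \<Omega>_open by (simp add: frontier_def interior_open)
qed

lemma exit_time_le: "x \<in> \<Omega> \<Longrightarrow> exit_time \<Omega> e x \<le> 2 * R"
proof -
  assume x: "x \<in> \<Omega>"
  have "closure \<Omega> \<subseteq> cball 0 R" using \<Omega>_bound by (intro closure_minimal) auto
  then have "norm (exit_point \<Omega> e x) \<le> R"
    using exit_point_in_frontier[OF x] by (auto simp: frontier_def)
  then have "norm (exit_time \<Omega> e x *\<^sub>R e) \<le> R + norm x"
    using norm_triangle_ineq4[of "exit_point \<Omega> e x" x] by (simp add: exit_point_def)
  then show ?thesis using \<Omega>_bound[OF x] exit_time_props(1)[of x] e_unit by simp
qed

text \<open>The exit time of an open set is lower semicontinuous: the points that leave \<open>\<Omega>\<close> up to time \<open>c\<close> are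
  the complement of \<open>\<Omega>\<close> shifted along a compact segment, a closed set.\<close>

lemma borel_measurable_exit_time [measurable]: "exit_time \<Omega> e \<in> borel_measurable borel"
proof (rule borel_measurableI_greater)
  fix c :: real
  have "closed {x. exit_time \<Omega> e x \<le> c}"
  proof (cases "c \<ge> 0")
    case True
    have "{x. exit_time \<Omega> e x \<le> c} = (\<Union>y\<in>- \<Omega>. \<Union>z\<in>(\<lambda>t. t *\<^sub>R e) ` {0..c}. {y - z})"
    proof (intro equalityI subsetI)
      fix x assume "x \<in> {x. exit_time \<Omega> e x \<le> c}"
      then have "x = exit_point \<Omega> e x - exit_time \<Omega> e x *\<^sub>R e" "exit_time \<Omega> e x \<in> {0..c}" "exit_point \<Omega> e x \<in> - \<Omega>"
        using exit_time_props(1,2)[of x] by (auto simp: exit_point_def)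
      then show "x \<in> (\<Union>y\<in>- \<Omega>. \<Union>z\<in>(\<lambda>t. t *\<^sub>R e) ` {0..c}. {y - z})" by blast
    next
      fix x assume "x \<in> (\<Union>y\<in>- \<Omega>. \<Union>z\<in>(\<lambda>t. t *\<^sub>R e) ` {0..c}. {y - z})"
      then obtain y t where "y \<notin> \<Omega>" "t \<in> {0..c}" "x = y - t *\<^sub>R e" by auto
      then have "\<not> t < exit_time \<Omega> e x" using exit_time_props(3)[of t x] by auto
      then show "x \<in> {x. exit_time \<Omega> e x \<le> c}" using \<open>t \<in> {0..c}\<close> by auto
    qed
    moreover have "compact ((\<lambda>t. t *\<^sub>R e) ` {0..c})"
      by (intro compact_continuous_image continuous_intros) auto
    moreover have "closed (- \<Omega>)" using \<Omega>_open by (simp add: closed_def)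
    ultimately show ?thesis
      by (simp only: closed_compact_differences)
  next
    case False
    then have "\<not> exit_time \<Omega> e x \<le> c" for x using exit_time_props(1)[of x] by linarith
    then show ?thesis by simp
  qed
  then have "{x. exit_time \<Omega> e x \<le> c} \<in> sets borel" by simp
  then have "- {x. exit_time \<Omega> e x \<le> c} \<in> sets borel" by (rule borel_comp)
  moreover have "- {x. exit_time \<Omega> e x \<le> c} = {x \<in> space borel. c < exit_time \<Omega> e x}" by auto
  ultimately show "{x \<in> space borel. c < exit_time \<Omega> e x} \<in> sets borel" by simp
qed

lemma borel_measurable_exit_point [measurable]: "exit_point \<Omega> e \<in> borel_measurable borel"
  unfolding exit_point_def by measurable

text \<open>The fundamental theorem of calculus on the segment from \<open>x\<close> to its exit point. The segment is then
  enlarged to the part of a segment of fixed length \<open>2 R\<close> in \<open>\<Omega>\<close>, so that the domain of integration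
  in \<open>t\<close> no longer depends on \<open>x\<close> except through the indicator of \<open>\<Omega>\<close>.\<close>

lemma abs_le_abs_exit_point_plus_line_integral:
  fixes f f' :: "'a \<Rightarrow> real"
  assumes deriv: "\<And>x. ((\<lambda>t. f (x + t *\<^sub>R e)) has_real_derivative f' x) (at 0)"
    and f': "continuous_on UNIV f'" and x: "x \<in> \<Omega>"
  shows "ennreal \<bar>f x\<bar> \<le> ennreal \<bar>f (exit_point \<Omega> e x)\<bar>
    + (\<integral>\<^sup>+t. indicator {0..2 * R} t * (ennreal \<bar>f' (x + t *\<^sub>R e)\<bar> * indicator \<Omega> (x + t *\<^sub>R e)) \<partial>lborel)"
proof -
  let ?\<tau> = "exit_time \<Omega> e x" and ?g = "\<lambda>t. f' (x + t *\<^sub>R e)"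
  have d: "((\<lambda>t. f (x + t *\<^sub>R e)) has_real_derivative ?g t) (at t)" for t
  proof -
    have "((\<lambda>s. f (x + t *\<^sub>R e + s *\<^sub>R e)) has_real_derivative ?g t) (at 0)"
      by (rule deriv)
    moreover have "(\<lambda>s. f (x + t *\<^sub>R e + s *\<^sub>R e)) = (\<lambda>s. f (x + (s + t) *\<^sub>R e))"
      by (simp add: algebra_simps)
    ultimately show ?thesis
      using DERIV_shift[of "\<lambda>t. f (x + t *\<^sub>R e)" "?g t" 0 t] by simp
  qed
  have cont: "isCont ?g t" for t
  proof -
    have "continuous_on UNIV ?g"
      by (rule continuous_on_compose2[OF f']) (auto intro!: continuous_intros)
    then show ?thesis by (simp add: continuous_on_eq_continuous_at)
  qed
  have int: "integrable lborel (\<lambda>t. ?g t * indicator {0..?\<tau>} t)"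
    by (rule borel_integrable_atLeastAtMost) (rule cont)
  have "(LINT t|lborel. ?g t * indicator {0..?\<tau>} t) = f (exit_point \<Omega> e x) - f (x + 0 *\<^sub>R e)"
    unfolding exit_point_def
    by (rule integral_FTC_Icc_real[where F = "\<lambda>t. f (x + t *\<^sub>R e)"]) (use d cont exit_time_props(1) in auto)
  then have "ennreal \<bar>f (exit_point \<Omega> e x) - f x\<bar> \<le> (\<integral>\<^sup>+t. norm (?g t * indicator {0..?\<tau>} t) \<partial>lborel)"
    using integral_norm_bound_ennreal[OF int] by simp
  also have "\<dots> \<le> (\<integral>\<^sup>+t. indicator {0..2 * R} t * (ennreal \<bar>f' (x + t *\<^sub>R e)\<bar> * indicator \<Omega> (x + t *\<^sub>R e)) \<partial>lborel)"
  proof (rule nn_integral_mono_AE)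
    have "norm (?g t * indicator {0..?\<tau>} t) \<le> indicator {0..2 * R} t * (ennreal \<bar>?g t\<bar> * indicator \<Omega> (x + t *\<^sub>R e))"
      \<comment> \<open>At the exit time itself the point is outside the open set; this single instant is a null set.\<close>
      if "t \<noteq> ?\<tau>" for t
      using that exit_time_props(3)[of t x] exit_time_le[OF x] by (auto simp: indicator_def)
    then show "AE t in lborel. norm (?g t * indicator {0..?\<tau>} t)
        \<le> indicator {0..2 * R} t * (ennreal \<bar>f' (x + t *\<^sub>R e)\<bar> * indicator \<Omega> (x + t *\<^sub>R e))"
      using AE_lborel_singleton[of ?\<tau>] by (auto elim: eventually_mono)
  qed
  finally have b: "ennreal \<bar>f (exit_point \<Omega> e x) - f x\<bar> \<le> \<dots>" .
  have "ennreal \<bar>f x\<bar> \<le> ennreal (\<bar>f (exit_point \<Omega> e x)\<bar> + \<bar>f (exit_point \<Omega> e x) - f x\<bar>)"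
    by (intro ennreal_leI) linarith
  also have "\<dots> = ennreal \<bar>f (exit_point \<Omega> e x)\<bar> + ennreal \<bar>f (exit_point \<Omega> e x) - f x\<bar>" by simp
  finally show ?thesis using b by (meson add_left_mono order_trans)
qed

lemma nn_integral_lebesgue_on_open:
  "(\<integral>\<^sup>+x. h x \<partial>lebesgue_on \<Omega>) = (\<integral>\<^sup>+x. h x * indicator \<Omega> x \<partial>lborel)"
  using \<Omega>_open by (simp add: nn_integral_restrict_space nn_integral_completion)

text \<open>The estimate on segments is integrated over \<open>\<Omega>\<close>. After exchanging the order of integration, translation
  invariance turns the inner integral into the integral of \<open>\<bar>f'\<bar>\<close> over \<open>\<Omega>\<close>, for every time in
  \<open>[0, 2 R]\<close>.\<close>

theorem friedrichs_inequality_L1: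
  fixes f f' :: "'a \<Rightarrow> real"
  assumes deriv: "\<And>x. ((\<lambda>t. f (x + t *\<^sub>R e)) has_real_derivative f' x) (at 0)"
    and f: "continuous_on UNIV f" and f': "continuous_on UNIV f'"
  shows "(\<integral>\<^sup>+x. ennreal \<bar>f x\<bar> \<partial>lebesgue_on \<Omega>)
    \<le> (\<integral>\<^sup>+x. ennreal \<bar>f (exit_point \<Omega> e x)\<bar> \<partial>lebesgue_on \<Omega>)
      + ennreal (2 * R) * (\<integral>\<^sup>+x. ennreal \<bar>f' x\<bar> \<partial>lebesgue_on \<Omega>)"
proof -
  have [measurable]: "f \<in> borel_measurable borel" "f' \<in> borel_measurable borel" "\<Omega> \<in> sets borel"
    using f f' \<Omega>_open by (auto intro: borel_measurable_continuous_onI)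
  define h where "h y = ennreal \<bar>f' y\<bar> * indicator \<Omega> y" for y
  have [measurable]: "h \<in> borel_measurable borel" unfolding h_def by measurable
  have shift: "(\<integral>\<^sup>+x. h (x + c) \<partial>lborel) = (\<integral>\<^sup>+x. h x \<partial>lborel)" for c
  proof -
    have "(\<integral>\<^sup>+x. h x \<partial>lborel) = (\<integral>\<^sup>+x. h x \<partial>distr lborel borel ((+) c))"
      by (simp add: lborel_distr_plus)
    also have "\<dots> = (\<integral>\<^sup>+x. h (c + x) \<partial>lborel)" by (rule nn_integral_distr) auto
    finally show ?thesis by (simp add: add.commute)
  qed
  have "(\<integral>\<^sup>+x. ennreal \<bar>f x\<bar> * indicator \<Omega> x \<partial>lborel)
    \<le> (\<integral>\<^sup>+x. ennreal \<bar>f (exit_point \<Omega> e x)\<bar> * indicator \<Omega> x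
        + (\<integral>\<^sup>+t. indicator {0..2 * R} t * h (x + t *\<^sub>R e) \<partial>lborel) \<partial>lborel)"
  proof (rule nn_integral_mono)
    fix x
    show "ennreal \<bar>f x\<bar> * indicator \<Omega> x \<le> ennreal \<bar>f (exit_point \<Omega> e x)\<bar> * indicator \<Omega> x
        + (\<integral>\<^sup>+t. indicator {0..2 * R} t * h (x + t *\<^sub>R e) \<partial>lborel)"
      using abs_le_abs_exit_point_plus_line_integral[OF deriv f', of x] by (simp add: h_def indicator_def)
  qed
  also have "\<dots> = (\<integral>\<^sup>+x. ennreal \<bar>f (exit_point \<Omega> e x)\<bar> * indicator \<Omega> x \<partial>lborel)
      + (\<integral>\<^sup>+x. (\<integral>\<^sup>+t. indicator {0..2 * R} t * h (x + t *\<^sub>R e) \<partial>lborel) \<partial>lborel)"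
    by (rule nn_integral_add) measurable
  also have "(\<integral>\<^sup>+x. (\<integral>\<^sup>+t. indicator {0..2 * R} t * h (x + t *\<^sub>R e) \<partial>lborel) \<partial>lborel)
      = (\<integral>\<^sup>+t. (\<integral>\<^sup>+x. indicator {0..2 * R} t * h (x + t *\<^sub>R e) \<partial>lborel) \<partial>lborel)"
    by (rule lborel_pair.Fubini') measurable
  also have "\<dots> = (\<integral>\<^sup>+t. (\<integral>\<^sup>+x. h x \<partial>lborel) * indicator {0..2 * R} t \<partial>lborel)"
    by (subst nn_integral_cmult) (simp_all add: shift mult.commute)
  also have "\<dots> = ennreal (2 * R) * (\<integral>\<^sup>+x. h x \<partial>lborel)"
    using R_pos by (simp add: nn_integral_cmult mult.commute)
  finally show ?thesis
    by (simp add: nn_integral_lebesgue_on_open h_def)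
qed

end

lemma emeasure_lborel_cylinder:
  fixes c :: "real ^ 'd"
  assumes "R \<ge> 0" "\<delta> \<ge> 0"
  shows "emeasure lborel {x. \<bar>x $ k\<bar> \<le> R \<and> (\<forall>j. j \<noteq> k \<longrightarrow> \<bar>x $ j - c $ j\<bar> \<le> \<delta>)}
    = ennreal (2 * R * (2 * \<delta>) ^ (CARD('d) - 1))"
proof -
  let ?a = "(\<chi> j. if j = k then - R else c $ j - \<delta>) :: real ^ 'd" and ?b = "(\<chi> j. if j = k then R else c $ j + \<delta>) :: real ^ 'd"
  have eq: "{x. \<bar>x $ k\<bar> \<le> R \<and> (\<forall>j. j \<noteq> k \<longrightarrow> \<bar>x $ j - c $ j\<bar> \<le> \<delta>)} = cbox ?a ?b"
    by (auto simp: mem_box_cart abs_le_iff split: if_splits) (smt (verit))+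
  have "cbox ?a ?b \<noteq> {}"
    using assms by (auto simp: interval_ne_empty_cart)
  then have "measure lborel (cbox ?a ?b) = (\<Prod>j\<in>UNIV. ?b $ j - ?a $ j)"
    by (rule content_cbox_cart)
  also have "\<dots> = (?b $ k - ?a $ k) * (\<Prod>j\<in>UNIV - {k}. ?b $ j - ?a $ j)"
    by (rule prod.remove) auto
  also have "(\<Prod>j\<in>UNIV - {k}. ?b $ j - ?a $ j) = (\<Prod>j\<in>UNIV - {k}. 2 * \<delta>)"
    by (rule prod.cong) auto
  also have "\<dots> = (2 * \<delta>) ^ (CARD('d) - 1)" by (simp add: card_Diff_singleton)
  finally have "measure lborel (cbox ?a ?b) = 2 * R * (2 * \<delta>) ^ (CARD('d) - 1)" by simp
  moreover have "emeasure lborel (cbox ?a ?b) = ennreal (measure lborel (cbox ?a ?b))"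
    using emeasure_lborel_cbox_finite[of ?a ?b] by (intro emeasure_eq_ennreal_measure) auto
  ultimately show ?thesis using eq by simp
qed

text \<open>The boundary term of the inequality is controlled by the surface measure since the push-forward of
  Lebesgue measure along exit points is dominated by a multiple of it. All points that exit through a
  set \<open>C\<close> lie in a cylinder with axis in the exit direction, of length \<open>2 R\<close> and with cross-section a
  cube of side \<open>2 diameter C\<close>. Its volume is a constant times the cost of \<open>C\<close> in the definition of the
  Hausdorff measure, so summing over a covering suffices.\<close>

lemma emeasure_exit_point_preimage_le:
  fixes \<Omega> :: "(real ^ 'd) set"
  assumes "line_exit \<Omega> (axis k 1) R" and A: "A \<in> sets borel"
  shows "emeasure lborel {x \<in> \<Omega>. exit_point \<Omega> (axis k 1) x \<in> A}
    \<le> ennreal (2 * R * 4 ^ (CARD('d) - 1) / unit_ball_vol (real (CARD('d) - 1))) * hausdorff_outer (CARD('d) - 1) A"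
proof -
  interpret line_exit \<Omega> "axis k 1" R by fact
  let ?s = "CARD('d) - 1" and ?\<pi> = "exit_point \<Omega> (axis k 1)"
  define \<alpha> where "\<alpha> = unit_ball_vol (real ?s)"
  define K where "K = 2 * R * 4 ^ ?s / \<alpha>"
  have \<alpha>: "\<alpha> > 0" by (simp add: \<alpha>_def)
  have K: "K > 0" using R_pos \<alpha> by (simp add: K_def)
  define m where "m = emeasure lborel {x \<in> \<Omega>. ?\<pi> x \<in> A}"
  define Z where "Z C = {x \<in> \<Omega>. ?\<pi> x \<in> C}" for C
  \<comment> \<open>The set of points that exit through \<open>C\<close> need not be measurable for arbitrary \<open>C\<close>; the enclosing cylinder is.\<close>
  have single: "\<exists>B\<in>sets lborel. Z C \<subseteq> B \<and> emeasure lborel B \<le> ennreal K * hausdorff_cost ?s C"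
    if C: "bounded C" for C
  proof (cases "C = {}")
    case True
    then show ?thesis by (intro bexI[of _ "{}"]) (auto simp: Z_def)
  next
    case False
    then obtain c where c: "c \<in> C" by blast
    let ?B = "{x. \<bar>x $ k\<bar> \<le> R \<and> (\<forall>j. j \<noteq> k \<longrightarrow> \<bar>x $ j - c $ j\<bar> \<le> diameter C)}"
    have "Z C \<subseteq> ?B"
    proof
      fix x assume "x \<in> Z C"
      then have x: "x \<in> \<Omega>" "?\<pi> x \<in> C" by (auto simp: Z_def)
      have "\<bar>x $ k\<bar> \<le> R" using component_le_norm_cart[of x k] \<Omega>_bound[OF x(1)] by linarith
      moreover have "\<bar>x $ j - c $ j\<bar> \<le> diameter C" if "j \<noteq> k" for j
      proof -
        have "x $ j = ?\<pi> x $ j" using that by (simp add: exit_point_def axis_def)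
        then have "\<bar>x $ j - c $ j\<bar> \<le> dist (?\<pi> x) c"
          using component_le_norm_cart[of "?\<pi> x - c" j] by (simp add: dist_norm)
        also have "\<dots> \<le> diameter C" by (rule diameter_bounded_bound[OF C x(2) c])
        finally show ?thesis .
      qed
      ultimately show "x \<in> ?B" by simp
    qed
    moreover have "emeasure lborel ?B = ennreal (2 * R * (2 * diameter C) ^ ?s)"
      using R_pos diameter_ge_0[OF C] by (intro emeasure_lborel_cylinder) auto
    moreover have "2 * R * (2 * diameter C) ^ ?s = K * (\<alpha> * (diameter C / 2) ^ ?s)"
    proof -
      have "(2 * diameter C) ^ ?s = (4 * (diameter C / 2)) ^ ?s" by simp
      also have "\<dots> = 4 ^ ?s * (diameter C / 2) ^ ?s" by (rule power_mult_distrib)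
      finally show ?thesis using \<alpha> by (simp add: K_def)
    qed
    then have "ennreal (2 * R * (2 * diameter C) ^ ?s) = ennreal K * hausdorff_cost ?s C"
      using False K \<alpha> diameter_ge_0[OF C] by (simp add: hausdorff_cost_def \<alpha>_def ennreal_mult)
    moreover have "?B \<in> sets lborel"
    proof -
      have "closed ?B"
        by (intro closed_Collect_conj closed_Collect_all closed_Collect_imp closed_Collect_le continuous_intros) auto
      then show ?thesis by simp
    qed
    ultimately show ?thesis by (intro bexI[of _ ?B] conjI) simp_all
  qed
  have "ennreal (1 / K) * m \<le> (\<Sum>i. hausdorff_cost ?s (C i))" if C: "C \<in> hausdorff_covers 1 A" for C
  proof -
    have "\<forall>i. \<exists>B\<in>sets lborel. Z (C i) \<subseteq> B \<and> emeasure lborel B \<le> ennreal K * hausdorff_cost ?s (C i)"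
      using single C by (auto simp: hausdorff_covers_def)
    then obtain B where B: "\<And>i. B i \<in> sets lborel" "\<And>i. Z (C i) \<subseteq> B i"
      "\<And>i. emeasure lborel (B i) \<le> ennreal K * hausdorff_cost ?s (C i)" by metis
    have "{x \<in> \<Omega>. ?\<pi> x \<in> A} \<subseteq> (\<Union>i. B i)"
      using B(2) C by (fastforce simp: hausdorff_covers_def Z_def)
    then have "m \<le> emeasure lborel (\<Union>i. B i)"
      unfolding m_def using B(1) by (intro emeasure_mono) auto
    also have "\<dots> \<le> (\<Sum>i. emeasure lborel (B i))"
      using B(1) by (intro emeasure_subadditive_countably) auto
    also have "\<dots> \<le> (\<Sum>i. ennreal K * hausdorff_cost ?s (C i))"
      by (intro suminf_le B) auto
    also have "\<dots> = ennreal K * (\<Sum>i. hausdorff_cost ?s (C i))" by simp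
    finally have "ennreal (1 / K) * m \<le> ennreal (1 / K) * (ennreal K * (\<Sum>i. hausdorff_cost ?s (C i)))"
      by (rule mult_left_mono) simp
    also have "\<dots> = (\<Sum>i. hausdorff_cost ?s (C i))"
      using K by (simp add: mult.assoc[symmetric] ennreal_mult[symmetric])
    finally show ?thesis .
  qed
  then have "ennreal (1 / K) * m \<le> (INF C\<in>hausdorff_covers 1 A. \<Sum>i. hausdorff_cost ?s (C i))"
    by (rule INF_greatest)
  also have "\<dots> \<le> hausdorff_outer ?s A"
    unfolding hausdorff_outer_def by (rule SUP_upper) simp
  finally have "ennreal K * (ennreal (1 / K) * m) \<le> ennreal K * hausdorff_outer ?s A"
    by (rule mult_left_mono) simp
  moreover have "ennreal K * (ennreal (1 / K) * m) = m"
    using K by (simp add: mult.assoc[symmetric] ennreal_mult[symmetric])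
  ultimately show ?thesis
    by (simp only: m_def K_def \<alpha>_def)
qed

lemma nn_integral_exit_point_le:
  fixes \<Omega> :: "(real ^ 'd) set"
  assumes le: "line_exit \<Omega> (axis k 1) R" and f[measurable]: "f \<in> borel_measurable borel"
  shows "(\<integral>\<^sup>+x. f (exit_point \<Omega> (axis k 1) x) \<partial>lebesgue_on \<Omega>)
    \<le> ennreal (2 * R * 4 ^ (CARD('d) - 1) / unit_ball_vol (real (CARD('d) - 1))) * (\<integral>\<^sup>+x. f x \<partial>surface_measure \<Omega>)"
proof -
  interpret line_exit \<Omega> "axis k 1" R by fact
  let ?s = "CARD('d) - 1" and ?\<pi> = "exit_point \<Omega> (axis k 1)"
  let ?K = "ennreal (2 * R * 4 ^ ?s / unit_ball_vol (real ?s))"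
  let ?H = "hausdorff_measure ?s :: (real ^ 'd) measure"
  have [measurable]: "\<Omega> \<in> sets borel" using \<Omega>_open by simp
  have fr[measurable]: "frontier \<Omega> \<in> sets borel" by (simp add: frontier_closed)
  have fH: "h \<in> borel_measurable ?H \<longleftrightarrow> h \<in> borel_measurable borel" for h :: "real ^ 'd \<Rightarrow> ennreal"
    by (simp cong: measurable_cong_sets)
  have N_meas: "(\<lambda>x. ?K * indicator (frontier \<Omega>) x) \<in> borel_measurable ?H" and f_meas: "f \<in> borel_measurable ?H"
    unfolding fH by measurable
  let ?M = "distr (density lborel (indicator \<Omega>)) borel ?\<pi>"
  let ?N = "density ?H (\<lambda>x. ?K * indicator (frontier \<Omega>) x)"
  have sp: "space ?H = UNIV" using sets_eq_imp_space_eq[OF sets_hausdorff_measure[of ?s]] by simp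
  have emeasure_le: "emeasure ?M A \<le> emeasure ?N A" for A
  proof (cases "A \<in> sets borel")
    case True
    then have pre: "?\<pi> -` A \<in> sets borel"
      using measurable_sets[OF borel_measurable_exit_point, of A] by simp
    have "emeasure ?M A = emeasure (density lborel (indicator \<Omega>)) (?\<pi> -` A)"
      using True by (subst emeasure_distr) auto
    also have "\<dots> = (\<integral>\<^sup>+x. indicator (\<Omega> \<inter> ?\<pi> -` A) x \<partial>lborel)"
      using pre by (subst emeasure_density) (auto simp: indicator_inter_arith intro!: nn_integral_cong simp del: nn_integral_indicator)
    also have "\<dots> = emeasure lborel {x \<in> \<Omega>. ?\<pi> x \<in> A}"
      using pre by (subst nn_integral_indicator) (auto intro!: arg_cong[where f = "emeasure lborel"])
    also have "{x \<in> \<Omega>. ?\<pi> x \<in> A} = {x \<in> \<Omega>. ?\<pi> x \<in> frontier \<Omega> \<inter> A}"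
      using exit_point_in_frontier by auto
    also have "emeasure lborel \<dots> \<le> ?K * hausdorff_outer ?s (frontier \<Omega> \<inter> A)"
      using True fr by (intro emeasure_exit_point_preimage_le[OF le]) auto
    also have "hausdorff_outer ?s (frontier \<Omega> \<inter> A) = emeasure ?H (frontier \<Omega> \<inter> A)"
      using True fr by (intro emeasure_hausdorff_measure[symmetric]) auto
    also have "?K * \<dots> = emeasure ?N A"
    proof -
      have "emeasure ?N A = (\<integral>\<^sup>+x. ?K * indicator (frontier \<Omega> \<inter> A) x \<partial>?H)"
        using True by (subst emeasure_density[OF N_meas]) (simp_all add: mult.assoc indicator_inter_arith)
      also have "\<dots> = ?K * emeasure ?H (frontier \<Omega> \<inter> A)"
        using True fr by (intro nn_integral_cmult_indicator) auto
      finally show ?thesis ..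
    qed
    finally show ?thesis .
  next
    case False
    then show ?thesis by (simp add: emeasure_notin_sets)
  qed
  have "?M \<le> ?N"
    unfolding le_measure_iff using emeasure_le sp by (simp add: le_fun_def)
  then have "(\<integral>\<^sup>+x. f x \<partial>?M) \<le> (\<integral>\<^sup>+x. f x \<partial>?N)"
    by (intro nn_integral_mono_measure) auto
  moreover have "(\<integral>\<^sup>+x. f x \<partial>?M) = (\<integral>\<^sup>+x. f (?\<pi> x) \<partial>lebesgue_on \<Omega>)"
    by (simp add: nn_integral_distr nn_integral_density nn_integral_lebesgue_on_open mult.commute)
  moreover have "(\<integral>\<^sup>+x. f x \<partial>?N) = ?K * (\<integral>\<^sup>+x. f x * indicator (frontier \<Omega>) x \<partial>?H)"
  proof -
    have "(\<integral>\<^sup>+x. f x \<partial>?N) = (\<integral>\<^sup>+x. ?K * (f x * indicator (frontier \<Omega>) x) \<partial>?H)"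
      unfolding nn_integral_density[OF N_meas f_meas] by (simp only: mult_ac)
    also have "\<dots> = ?K * (\<integral>\<^sup>+x. f x * indicator (frontier \<Omega>) x \<partial>?H)"
      by (intro nn_integral_cmult) (simp only: fH, measurable)
    finally show ?thesis .
  qed
  moreover have "(\<integral>\<^sup>+x. f x \<partial>surface_measure \<Omega>) = (\<integral>\<^sup>+x. f x * indicator (frontier \<Omega>) x \<partial>?H)"
    unfolding surface_measure_def
    by (subst nn_integral_restrict_space) (auto simp: nn_integral_completion intro!: sets.Int_space_eq2)
  ultimately show ?thesis by simp
qed

section \<open>Functions with vanishing weak gradient and trace\<close>

text \<open>On a finite measure, \<open>L\<^sup>p\<close> convergence implies \<open>L\<^sup>1\<close> convergence. Instead of Hoelder's inequality the
  proof uses \<open>y \<le> \<epsilon> + \<epsilon> powr (1 - p) * y powr p\<close>, which is trivial for \<open>y \<le> \<epsilon>\<close> and otherwise follows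
  from the monotonicity of \<open>powr (1 - p)\<close>.\<close>

lemma nn_integral_tendsto_0_if_powr_tendsto_0:
  fixes f :: "nat \<Rightarrow> 'a \<Rightarrow> 'b::real_normed_vector"
  assumes lim: "(\<lambda>n. \<integral>\<^sup>+x. ennreal (norm (f n x) powr p) \<partial>M) \<longlonglongrightarrow> 0" and p: "p \<ge> 1"
    and fin: "emeasure M (space M) < \<infinity>" and meas: "\<And>n. (\<lambda>x. norm (f n x)) \<in> borel_measurable M"
  shows "(\<lambda>n. \<integral>\<^sup>+x. ennreal (norm (f n x)) \<partial>M) \<longlonglongrightarrow> 0"
proof (rule order_tendstoI)
  note meas[measurable]
  fix a :: ennreal assume "0 < a"
  then obtain b' where b': "0 < b'" "b' < a" using dense by blast
  then obtain b where b: "b' = ennreal b" "b > 0" by (cases b') auto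
  define m where "m = measure M (space M)"
  have m: "emeasure M (space M) = ennreal m" "m \<ge> 0"
    using fin by (auto simp: m_def emeasure_eq_ennreal_measure)
  define \<epsilon> where "\<epsilon> = b / (2 * (m + 1))"
  have \<epsilon>: "\<epsilon> > 0" "\<epsilon> * m \<le> b / 2" using b m by (auto simp: \<epsilon>_def field_simps)
  have pw: "y \<le> \<epsilon> + \<epsilon> powr (1 - p) * y powr p" if "y \<ge> 0" for y
  proof (cases "y \<le> \<epsilon>")
    case True
    then show ?thesis by (simp add: add_increasing2)
  next
    case False
    then have "y = y powr (1 - p) * y powr p" using \<epsilon> by (simp add: powr_add[symmetric])
    also have "\<dots> \<le> \<epsilon> powr (1 - p) * y powr p"
      using False \<epsilon> p by (intro mult_right_mono powr_mono2') auto
    finally show ?thesis using \<epsilon> by simp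
  qed
  let ?I = "\<lambda>n. \<integral>\<^sup>+x. ennreal (norm (f n x) powr p) \<partial>M"
  have bound: "(\<integral>\<^sup>+x. ennreal (norm (f n x)) \<partial>M) \<le> ennreal (b / 2) + ennreal (\<epsilon> powr (1 - p)) * ?I n" for n
  proof -
    have "(\<integral>\<^sup>+x. ennreal (norm (f n x)) \<partial>M)
      \<le> (\<integral>\<^sup>+x. ennreal \<epsilon> + ennreal (\<epsilon> powr (1 - p)) * ennreal (norm (f n x) powr p) \<partial>M)"
      using \<epsilon> by (intro nn_integral_mono) (simp add: ennreal_mult[symmetric] ennreal_plus[symmetric] pw ennreal_leI del: ennreal_plus)
    also have "\<dots> = ennreal \<epsilon> * ennreal m + ennreal (\<epsilon> powr (1 - p)) * ?I n"
      by (subst nn_integral_add) (auto simp: nn_integral_cmult m)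
    also have "ennreal \<epsilon> * ennreal m \<le> ennreal (b / 2)"
      using \<epsilon> m by (simp add: ennreal_mult[symmetric] ennreal_leI)
    finally show ?thesis by (simp add: add_right_mono)
  qed
  have "(\<lambda>n. ennreal (\<epsilon> powr (1 - p)) * ?I n) \<longlonglongrightarrow> ennreal (\<epsilon> powr (1 - p)) * 0"
    by (intro ennreal_tendsto_cmult lim) auto
  then have "\<forall>\<^sub>F n in sequentially. ennreal (\<epsilon> powr (1 - p)) * ?I n < ennreal (b / 2)"
    using b by (intro order_tendstoD(2)) auto
  then show "\<forall>\<^sub>F n in sequentially. (\<integral>\<^sup>+x. ennreal (norm (f n x)) \<partial>M) < a"
  proof eventually_elim
    case (elim n)
    have "ennreal (b / 2) + ennreal (\<epsilon> powr (1 - p)) * ?I n \<le> ennreal (b / 2) + ennreal (b / 2)"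
      using elim by (intro add_left_mono) simp
    also have "\<dots> = ennreal b" using b by (simp add: ennreal_plus[symmetric] del: ennreal_plus)
    finally show ?case using bound[of n] b b' by simp
  qed
qed simp

text \<open>The Friedrichs inequality is applied to each component of the \<open>C\<^sup>1\<close> approximations of \<open>v\<close>, in one
  fixed coordinate direction. Their gradients tend to zero in \<open>\<Omega>\<close> and their boundary values tend to
  zero in the surface measure, hence so do the approximations themselves.\<close>

theorem sobolev_zero_vanishes_if_gradient_vanishes:
  fixes v :: "real ^ 'd \<Rightarrow> real ^ 'k"
  assumes \<Omega>: "open \<Omega>" "bounded \<Omega>" and p: "p \<ge> 1"
    and v: "v \<in> sobolev_zero \<Omega> p" and grad: "AE x in lebesgue_on \<Omega>. weak_grad \<Omega> v x = 0"
  shows "AE x in lebesgue_on \<Omega>. v x = 0"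
proof -
  obtain R where R: "R > 0" "\<And>x. x \<in> \<Omega> \<Longrightarrow> norm x \<le> R"
    using \<Omega>(2) by (auto simp: bounded_pos)
  obtain \<phi> J where C1: "\<And>n. has_C1_jacobian (\<phi> n) (J n)"
    and lim: "Lp_tendsto (lebesgue_on \<Omega>) p \<phi> v" "Lp_tendsto (lebesgue_on \<Omega>) p J (weak_grad \<Omega> v)"
      "Lp_tendsto (surface_measure \<Omega>) p \<phi> (\<lambda>_. 0)"
    using v by (auto simp: sobolev_bdry_def has_trace_def)
  have [measurable]: "v \<in> borel_measurable (lebesgue_on \<Omega>)"
    using v by (auto simp: sobolev_bdry_def sobolev_def Lp_fun_def)
  have \<phi>c: "continuous_on UNIV (\<phi> n)" and Jc: "continuous_on UNIV (J n)" for n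
    using C1[of n] has_C1_jacobian_continuous by (auto simp: has_C1_jacobian_def)
  have [measurable]: "\<phi> n \<in> borel_measurable (lebesgue_on \<Omega>)" "J n \<in> borel_measurable (lebesgue_on \<Omega>)" for n
    by (intro continuous_measurable_lebesgue_on \<phi>c Jc)+
  have [measurable]: "\<phi> n \<in> borel_measurable borel" for n
    by (intro borel_measurable_continuous_onI \<phi>c)
  \<comment> \<open>Any fixed coordinate direction serves.\<close>
  define k where "k = (undefined :: 'd)"
  let ?e = "axis k 1 :: real ^ 'd"
  have le: "line_exit \<Omega> ?e R"
    using \<Omega> R by unfold_locales (auto simp: norm_axis_1)
  interpret line_exit \<Omega> ?e R by (rule le)
  have fin: "emeasure (lebesgue_on \<Omega>) (space (lebesgue_on \<Omega>)) < \<infinity>"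
    using \<Omega> emeasure_bounded_finite[OF \<Omega>(2)] by (simp add: emeasure_restrict_space)
  have \<pi>[measurable]: "exit_point \<Omega> ?e \<in> lebesgue_on \<Omega> \<rightarrow>\<^sub>M borel"
    by (intro measurable_restrict_space1 measurable_completion) simp
  have a: "(\<lambda>n. \<integral>\<^sup>+x. ennreal (norm (\<phi> n x - v x)) \<partial>lebesgue_on \<Omega>) \<longlonglongrightarrow> 0"
    using lim(1) unfolding Lp_tendsto_def by (rule nn_integral_tendsto_0_if_powr_tendsto_0[OF _ p fin]) measurable
  have "(\<lambda>n. \<integral>\<^sup>+x. ennreal (norm (J n x) powr p) \<partial>lebesgue_on \<Omega>) \<longlonglongrightarrow> 0"
    using Lp_tendsto_cong_AE[OF lim(2) grad] by (simp add: Lp_tendsto_def)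
  then have c: "(\<lambda>n. \<integral>\<^sup>+x. ennreal (norm (J n x)) \<partial>lebesgue_on \<Omega>) \<longlonglongrightarrow> 0"
    by (rule nn_integral_tendsto_0_if_powr_tendsto_0[OF _ p fin]) measurable
  define K where "K = ennreal (2 * R * 4 ^ (CARD('d) - 1) / unit_ball_vol (real (CARD('d) - 1)))"
  have "(\<lambda>n. \<integral>\<^sup>+x. ennreal (norm (\<phi> n (exit_point \<Omega> ?e x)) powr p) \<partial>lebesgue_on \<Omega>) \<longlonglongrightarrow> 0"
  proof (rule tendsto_sandwich[OF _ _ tendsto_const])
    show "\<forall>\<^sub>F n in sequentially. (\<integral>\<^sup>+x. ennreal (norm (\<phi> n (exit_point \<Omega> ?e x)) powr p) \<partial>lebesgue_on \<Omega>)
        \<le> K * (\<integral>\<^sup>+x. ennreal (norm (\<phi> n x) powr p) \<partial>surface_measure \<Omega>)"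
      unfolding K_def
      by (intro always_eventually allI nn_integral_exit_point_le[OF le, of "\<lambda>y. ennreal (norm (\<phi> _ y) powr p)"]) measurable
    have "(\<lambda>n. K * (\<integral>\<^sup>+x. ennreal (norm (\<phi> n x) powr p) \<partial>surface_measure \<Omega>)) \<longlonglongrightarrow> K * 0"
      using lim(3) by (intro ennreal_tendsto_cmult) (auto simp: Lp_tendsto_def K_def)
    then show "(\<lambda>n. K * (\<integral>\<^sup>+x. ennreal (norm (\<phi> n x) powr p) \<partial>surface_measure \<Omega>)) \<longlonglongrightarrow> 0" by simp
  qed auto
  then have b: "(\<lambda>n. \<integral>\<^sup>+x. ennreal (norm (\<phi> n (exit_point \<Omega> ?e x))) \<partial>lebesgue_on \<Omega>) \<longlonglongrightarrow> 0"
    by (rule nn_integral_tendsto_0_if_powr_tendsto_0[OF _ p fin]) measurable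
  have comp: "AE x in lebesgue_on \<Omega>. v x $ i = 0" for i
  proof -
    let ?A = "\<lambda>n. \<integral>\<^sup>+x. ennreal (norm (\<phi> n x - v x)) \<partial>lebesgue_on \<Omega>"
    let ?B = "\<lambda>n. \<integral>\<^sup>+x. ennreal (norm (\<phi> n (exit_point \<Omega> ?e x))) \<partial>lebesgue_on \<Omega>"
    let ?C = "\<lambda>n. \<integral>\<^sup>+x. ennreal (norm (J n x)) \<partial>lebesgue_on \<Omega>"
    have "(\<integral>\<^sup>+x. ennreal \<bar>v x $ i\<bar> \<partial>lebesgue_on \<Omega>) \<le> ?A n + (?B n + ennreal (2 * R) * ?C n)" for n
    proof -
      have "((\<lambda>t. \<phi> n (x + t *\<^sub>R ?e) $ i) has_real_derivative J n x $ i $ k) (at 0)" for x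
      proof -
        have "((\<lambda>t. x + t *\<^sub>R ?e) has_derivative (\<lambda>t. t *\<^sub>R ?e)) (at 0)"
          by (auto intro!: derivative_eq_intros)
        moreover have "(\<phi> n has_derivative (\<lambda>h. J n x *v h)) (at (x + 0 *\<^sub>R ?e))"
          using C1[of n] by (simp add: has_C1_jacobian_def)
        ultimately have "((\<lambda>t. \<phi> n (x + t *\<^sub>R ?e)) has_derivative (\<lambda>t. J n x *v (t *\<^sub>R ?e))) (at 0)"
          by (rule has_derivative_compose)
        then have "((\<lambda>t. \<phi> n (x + t *\<^sub>R ?e) $ i) has_derivative (\<lambda>t. (J n x *v (t *\<^sub>R ?e)) $ i)) (at 0)"
          by (rule bounded_linear.has_derivative[OF bounded_linear_vec_nth])
        moreover have "(J n x *v (t *\<^sub>R ?e)) $ i = J n x $ i $ k * t" for t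
          by (simp add: matrix_vector_mult_scaleR matrix_vector_mult_basis column_def)
        ultimately show ?thesis by (simp add: has_field_derivative_def)
      qed
      moreover have "continuous_on UNIV (\<lambda>x. \<phi> n x $ i)" "continuous_on UNIV (\<lambda>x. J n x $ i $ k)"
        using \<phi>c[of n] Jc[of n] by (auto intro!: continuous_intros)
      ultimately have "(\<integral>\<^sup>+x. ennreal \<bar>\<phi> n x $ i\<bar> \<partial>lebesgue_on \<Omega>)
        \<le> (\<integral>\<^sup>+x. ennreal \<bar>\<phi> n (exit_point \<Omega> ?e x) $ i\<bar> \<partial>lebesgue_on \<Omega>)
          + ennreal (2 * R) * (\<integral>\<^sup>+x. ennreal \<bar>J n x $ i $ k\<bar> \<partial>lebesgue_on \<Omega>)"
        by (rule friedrichs_inequality_L1)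
      also have "\<dots> \<le> ?B n + ennreal (2 * R) * ?C n"
      proof (intro add_mono mult_left_mono nn_integral_mono ennreal_leI)
        show "\<bar>J n x $ i $ k\<bar> \<le> norm (J n x)" for x
          by (rule order_trans[OF component_le_norm_cart Finite_Cartesian_Product.norm_nth_le])
      qed (auto intro: component_le_norm_cart)
      finally have F: "(\<integral>\<^sup>+x. ennreal \<bar>\<phi> n x $ i\<bar> \<partial>lebesgue_on \<Omega>) \<le> ?B n + ennreal (2 * R) * ?C n" .
      have "(\<integral>\<^sup>+x. ennreal \<bar>v x $ i\<bar> \<partial>lebesgue_on \<Omega>)
        \<le> (\<integral>\<^sup>+x. ennreal (norm (\<phi> n x - v x)) + ennreal \<bar>\<phi> n x $ i\<bar> \<partial>lebesgue_on \<Omega>)"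
      proof (rule nn_integral_mono)
        fix x
        have "\<bar>v x $ i\<bar> \<le> norm (\<phi> n x - v x) + \<bar>\<phi> n x $ i\<bar>"
          using component_le_norm_cart[of "\<phi> n x - v x" i] by simp
        then show "ennreal \<bar>v x $ i\<bar> \<le> ennreal (norm (\<phi> n x - v x)) + ennreal \<bar>\<phi> n x $ i\<bar>"
          by (simp add: ennreal_plus[symmetric] ennreal_leI del: ennreal_plus)
      qed
      also have "\<dots> = ?A n + (\<integral>\<^sup>+x. ennreal \<bar>\<phi> n x $ i\<bar> \<partial>lebesgue_on \<Omega>)"
      proof (rule nn_integral_add)
        have "(\<lambda>x. \<phi> n x $ i) \<in> borel_measurable (lebesgue_on \<Omega>)"
          using \<phi>c[of n] by (intro continuous_measurable_lebesgue_on continuous_intros)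
        then show "(\<lambda>x. ennreal \<bar>\<phi> n x $ i\<bar>) \<in> borel_measurable (lebesgue_on \<Omega>)" by measurable
      qed measurable
      also have "\<dots> \<le> ?A n + (?B n + ennreal (2 * R) * ?C n)" by (intro add_left_mono F)
      finally show ?thesis .
    qed
    moreover have "(\<lambda>n. ?A n + (?B n + ennreal (2 * R) * ?C n)) \<longlonglongrightarrow> 0 + (0 + ennreal (2 * R) * 0)"
      by (intro tendsto_add a b c ennreal_tendsto_cmult) auto
    ultimately have "(\<integral>\<^sup>+x. ennreal \<bar>v x $ i\<bar> \<partial>lebesgue_on \<Omega>) \<le> 0"
      by (intro LIMSEQ_le_const[where X = "\<lambda>n. ?A n + (?B n + ennreal (2 * R) * ?C n)"]) auto
    then have "(\<integral>\<^sup>+x. ennreal \<bar>v x $ i\<bar> \<partial>lebesgue_on \<Omega>) = 0" by simp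
    moreover have "(\<lambda>x. v x $ i) \<in> borel_measurable (lebesgue_on \<Omega>)"
      using borel_measurable_inner[of v "lebesgue_on \<Omega>" "\<lambda>_. axis i 1"] by (simp add: inner_axis)
    ultimately have "AE x in lebesgue_on \<Omega>. ennreal \<bar>v x $ i\<bar> = 0"
      by (subst (asm) nn_integral_0_iff_AE) auto
    then show ?thesis by eventually_elim simp
  qed
  then have "AE x in lebesgue_on \<Omega>. \<forall>i\<in>UNIV. v x $ i = 0"
    by (intro AE_finite_allI) auto
  then show ?thesis by eventually_elim (simp add: vec_eq_iff)
qed

section \<open>Measurability of superpositions\<close>

text \<open>The inner function is approximated by functions with values in a countable dense subset of \<open>S\<close>; for
  these the superposition is a countable patchwork of measurable functions. Approximating with values
  in \<open>S\<close> is essential since \<open>f\<close> is controlled only there.\<close>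

lemma caratheodory_superposition_measurable:
  fixes f :: "real ^ 'd \<Rightarrow> 'b::euclidean_space \<Rightarrow> real"
  assumes f: "caratheodory_fun \<Omega> S f" and \<Omega>: "\<Omega> \<in> sets lebesgue"
    and w[measurable]: "w \<in> borel_measurable (lebesgue_on \<Omega>)" and wS: "AE x in lebesgue_on \<Omega>. w x \<in> S"
  shows "(\<lambda>x. f x (w x)) \<in> borel_measurable (lebesgue_on \<Omega>)"
proof (cases "S = {}")
  case True
  from wS have eq: "AE x in lebesgue_on \<Omega>. 0 = f x (w x)" by eventually_elim (simp add: True)
  show ?thesis
    by (rule borel_measurable_lebesgue_on_AE[OF _ \<Omega> eq]) simp
next
  case False
  obtain T where T: "countable T" "T \<subseteq> S" "S \<subseteq> closure T" by (rule separable)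
  then have Tne: "T \<noteq> {}" using False by auto
  define d where "d = from_nat_into T"
  have dS: "d n \<in> S" for n using T(2) from_nat_into[OF Tne] by (auto simp: d_def)
  define q where "q m x = (LEAST n. dist (d n) (w x) < inverse (real (Suc m)))" for m x
  have meas: "(\<lambda>x. f x (d (q m x))) \<in> borel_measurable (lebesgue_on \<Omega>)" for m
  proof (rule measurable_compose_countable[where f = "\<lambda>n x. f x (d n)"])
    show "(\<lambda>x. f x (d n)) \<in> borel_measurable (lebesgue_on \<Omega>)" for n
      using f dS by (auto simp: caratheodory_fun_def)
    show "q m \<in> lebesgue_on \<Omega> \<rightarrow>\<^sub>M count_space UNIV"
      unfolding q_def by measurable
  qed
  have "AE x in lebesgue_on \<Omega>. continuous_on S (f x)" using f by (simp add: caratheodory_fun_def)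
  then have eq: "AE x in lebesgue_on \<Omega>. lim (\<lambda>m. f x (d (q m x))) = f x (w x)"
    using wS
  proof eventually_elim
    case (elim x)
    have close: "dist (d (q m x)) (w x) < inverse (real (Suc m))" for m
    proof -
      have "w x \<in> closure T" using elim T by auto
      then obtain y where "y \<in> T" "dist y (w x) < inverse (real (Suc m))"
        unfolding closure_approachable by (metis inverse_positive_iff_positive of_nat_0_less_iff zero_less_Suc)
      then have "\<exists>n. dist (d n) (w x) < inverse (real (Suc m))"
        using from_nat_into_surj[OF T(1)] by (metis d_def)
      then show ?thesis unfolding q_def by (rule LeastI_ex)
    qed
    have "(\<lambda>m. dist (d (q m x)) (w x)) \<longlonglongrightarrow> 0"
      by (rule tendsto_sandwich[OF _ _ tendsto_const LIMSEQ_inverse_real_of_nat])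
        (use close in \<open>simp_all add: less_imp_le del: of_nat_Suc\<close>)
    then have "(\<lambda>m. d (q m x)) \<longlonglongrightarrow> w x" by (rule tendsto_dist_iff[THEN iffD2])
    then have "(\<lambda>m. f x (d (q m x))) \<longlonglongrightarrow> f x (w x)"
      by (rule continuous_on_tendsto_compose[OF elim(1)]) (use elim(2) dS in auto)
    then show ?case by (rule limI)
  qed
  show ?thesis
    by (rule borel_measurable_lebesgue_on_AE[OF _ \<Omega> eq]) (intro borel_measurable_lim_metric meas)
qed

section \<open>Tangent inequalities\<close>

lemma eventually_segment_in_open:
  fixes y z :: "'a::real_normed_vector"
  assumes "open D" "y \<in> D"
  shows "\<forall>\<^sub>F t in at_right (0::real). 0 < t \<and> t < 1 \<and> (1 - t) *\<^sub>R y + t *\<^sub>R z \<in> D"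
proof -
  have "((\<lambda>t. (1 - t) *\<^sub>R y + t *\<^sub>R z) \<longlongrightarrow> (1 - 0) *\<^sub>R y + 0 *\<^sub>R z) (at_right (0::real))"
    by (intro tendsto_intros)
  then have "\<forall>\<^sub>F t in at_right (0::real). (1 - t) *\<^sub>R y + t *\<^sub>R z \<in> D"
    using assms by (intro topological_tendstoD) auto
  moreover have "\<forall>\<^sub>F t in at_right (0::real). t \<in> {0<..<1}"
    by (rule eventually_at_right_less[THEN eventually_conj, OF eventually_at_right_real[of 0 1], THEN eventually_mono]) auto
  ultimately show ?thesis by eventually_elim auto
qed

text \<open>The segment from \<open>y\<close> to \<open>z\<close> may leave \<open>D\<close>, but it stays in \<open>D\<close> near \<open>y\<close> and its difference quotients
  there are bounded by \<open>f z - f y\<close>, by convexity of an extension to the convex hull. This is all that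
  the derivative at \<open>y\<close> sees.\<close>

lemma convex_fun_on_above_tangent:
  assumes D: "open D" and f: "convex_fun_on D f" and y: "y \<in> D" and z: "z \<in> D"
    and G: "GDERIV f y :> G"
  shows "f y + G \<bullet> (z - y) \<le> f z"
proof -
  obtain h where h: "convex_on (convex hull D) h" "\<And>x. x \<in> D \<Longrightarrow> h x = f x"
    using f by (auto simp: convex_fun_on_def)
  have yz: "y \<in> convex hull D" "z \<in> convex hull D" using y z hull_subset[of D convex] by auto
  have "((\<lambda>t. f (y + t *\<^sub>R (z - y))) has_real_derivative G \<bullet> (z - y)) (at 0)"
  proof -
    have "((\<lambda>t. y + t *\<^sub>R (z - y)) has_derivative (\<lambda>t. t *\<^sub>R (z - y))) (at 0)"
      by (auto intro!: derivative_eq_intros)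
    moreover have "(f has_derivative (\<lambda>h. h \<bullet> G)) (at (y + 0 *\<^sub>R (z - y)))"
      using G by (simp add: gderiv_def)
    ultimately have "((\<lambda>t. f (y + t *\<^sub>R (z - y))) has_derivative (\<lambda>t. t *\<^sub>R (z - y) \<bullet> G)) (at 0)"
      by (rule has_derivative_compose)
    moreover have "(\<lambda>t. t *\<^sub>R (z - y) \<bullet> G) = (*) (G \<bullet> (z - y))"
      by (auto simp: inner_commute mult.commute)
    ultimately show ?thesis by (simp add: has_field_derivative_def)
  qed
  then have "((\<lambda>t. (f (y + t *\<^sub>R (z - y)) - f y) / t) \<longlongrightarrow> G \<bullet> (z - y)) (at 0)"
    by (simp add: has_field_derivative_iff)
  then have lim: "((\<lambda>t. (f (y + t *\<^sub>R (z - y)) - f y) / t) \<longlongrightarrow> G \<bullet> (z - y)) (at_right 0)"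
    by (rule tendsto_within_subset) auto
  have "\<forall>\<^sub>F t in at_right 0. (f (y + t *\<^sub>R (z - y)) - f y) / t \<le> f z - f y"
    using eventually_segment_in_open[OF D y, of z]
  proof eventually_elim
    case (elim t)
    have seg: "y + t *\<^sub>R (z - y) = (1 - t) *\<^sub>R y + t *\<^sub>R z" by (simp add: algebra_simps)
    have "h ((1 - t) *\<^sub>R y + t *\<^sub>R z) \<le> (1 - t) * h y + t * h z"
      using elim yz by (intro convex_onD[OF h(1)]) auto
    then have "f (y + t *\<^sub>R (z - y)) \<le> (1 - t) * f y + t * f z"
      using h(2) elim y z by (simp add: seg)
    then have "f (y + t *\<^sub>R (z - y)) - f y \<le> t * (f z - f y)" by (simp add: algebra_simps)
    then show ?case using elim by (simp add: pos_divide_le_eq mult.commute)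
  qed
  from tendsto_upperbound[OF lim this] show ?thesis by simp
qed

text \<open>If the tangent touched a second time at \<open>z\<close>, then \<open>f\<close> would lie strictly below the tangent at points
  of the segment close to \<open>y\<close>. As \<open>D\<close> is open, such points are in \<open>D\<close> although it need not be convex.\<close>

lemma strictly_convex_touches_tangent_once:
  assumes S: "strictly_convex_fun_on S f" and D: "open D" "D \<subseteq> S" and y: "y \<in> D" and z: "z \<in> S"
    and tangent: "\<And>m. m \<in> D \<Longrightarrow> f y + G \<bullet> (m - y) \<le> f m" and touch: "f z = f y + G \<bullet> (z - y)"
  shows "z = y"
proof (rule ccontr)
  assume "z \<noteq> y"
  from eventually_happens'[OF _ eventually_segment_in_open[OF D(1) y, of z]]
  obtain t :: real where t: "0 < t" "t < 1" "(1 - t) *\<^sub>R y + t *\<^sub>R z \<in> D" by auto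
  have "f ((1 - t) *\<^sub>R y + t *\<^sub>R z) < (1 - t) * f y + t * f z"
    using S D(2) y z t \<open>z \<noteq> y\<close> unfolding strictly_convex_fun_on_def by (metis subsetD)
  also have "\<dots> = f y + G \<bullet> ((1 - t) *\<^sub>R y + t *\<^sub>R z - y)"
    by (simp add: touch algebra_simps inner_diff_right inner_add_right)
  also have "\<dots> \<le> f ((1 - t) *\<^sub>R y + t *\<^sub>R z)" by (rule tangent[OF t(3)])
  finally show False by simp
qed

lemma convex_fun_on_UNIV: "convex_on UNIV f \<Longrightarrow> convex_fun_on UNIV f"
  by (auto simp: convex_fun_on_def hull_UNIV)

section \<open>The functional of the push-forward\<close>

text \<open>The subdifferential is defined through the Legendre transform; comparing its supremum with
  the term at \<open>\<nu>\<close> gives back the usual inequality for a subgradient.\<close>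

lemma measure_subdifferentialD:
  assumes \<omega>: "\<omega> \<in> measure_subdifferential D \<Phi> \<mu>" and \<nu>: "\<nu> \<in> pos_measures D"
  shows "\<Phi> \<mu> + ereal ((LINT y:closure D|\<nu>. \<omega> y) - (LINT y:closure D|\<mu>. \<omega> y)) \<le> \<Phi> \<nu>"
proof -
  have "ereal (LINT y:closure D|\<nu>. \<omega> y) - \<Phi> \<nu> \<le> legendre_transform D \<Phi> \<omega>"
    unfolding legendre_transform_def using \<nu> by (rule SUP_upper)
  also have "\<dots> = ereal (LINT y:closure D|\<mu>. \<omega> y) - \<Phi> \<mu>" using \<omega> by (simp add: measure_subdifferential_def)
  finally have "ereal (LINT y:closure D|\<nu>. \<omega> y) - \<Phi> \<nu> \<le> \<dots>" .
  moreover have "\<Phi> \<mu> < \<infinity>" using \<omega> by (simp add: measure_subdifferential_def)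
  ultimately show ?thesis
    by (cases "\<Phi> \<mu>"; cases "\<Phi> \<nu>") auto
qed

lemma push_lebesgue_in_pos_measures:
  assumes \<Omega>: "open \<Omega>" "bounded \<Omega>" and w: "w \<in> borel_measurable (lebesgue_on \<Omega>)"
    and wD: "AE x in lebesgue_on \<Omega>. w x \<in> D"
  shows "push_lebesgue \<Omega> w \<in> pos_measures D"
proof -
  have "emeasure (lebesgue_on \<Omega>) (space (lebesgue_on \<Omega>)) < \<infinity>"
    using \<Omega> emeasure_bounded_finite[OF \<Omega>(2)] by (simp add: emeasure_restrict_space)
  then have "finite_measure (lebesgue_on \<Omega>)" by (intro finite_measureI) auto
  then have "finite_measure (distr (lebesgue_on \<Omega>) borel w)"
    using w by (intro finite_measure.finite_measure_distr)
  moreover have "emeasure (distr (lebesgue_on \<Omega>) borel w) (- closure D) = 0"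
  proof -
    have "AE y in distr (lebesgue_on \<Omega>) borel w. y \<notin> - closure D"
    proof (subst AE_distr_iff[OF w])
      show "{y \<in> space borel. y \<notin> - closure D} \<in> sets borel" by simp
      show "AE x in lebesgue_on \<Omega>. w x \<notin> - closure D"
        using wD by eventually_elim (use closure_subset in auto)
    qed
    then have "- closure D \<in> null_sets (distr (lebesgue_on \<Omega>) borel w)"
      by (subst AE_iff_null_sets) auto
    then show ?thesis by auto
  qed
  ultimately show ?thesis by (simp add: push_lebesgue_def pos_measures_def)
qed

text \<open>Integration of \<open>h\<close> against the push-forward, where \<open>h\<close> is meaningful on the closure of \<open>D\<close> only; the
  extension \<open>he\<close> supplies measurability on the whole space.\<close>

lemma integral_push_lebesgue:
  fixes h he :: "real ^ 'k \<Rightarrow> real"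
  assumes \<Omega>: "open \<Omega>" "bounded \<Omega>" and D: "bounded D" and w[measurable]: "w \<in> borel_measurable (lebesgue_on \<Omega>)"
    and wD: "AE x in lebesgue_on \<Omega>. w x \<in> D"
    and he: "continuous_on UNIV he" and eq: "\<And>y. y \<in> closure D \<Longrightarrow> he y = h y"
  shows "(LINT y:closure D|push_lebesgue \<Omega> w. h y) = (LINT x|lebesgue_on \<Omega>. he (w x))"
    and "integrable (lebesgue_on \<Omega>) (\<lambda>x. he (w x))"
proof -
  have he_m: "he \<in> borel_measurable borel" using he by (rule borel_measurable_continuous_onI)
  have [measurable]: "(\<lambda>x. he (w x)) \<in> borel_measurable (lebesgue_on \<Omega>)"
    by (rule measurable_compose[OF w he_m])
  have ind: "(\<lambda>y. indicator (closure D) y * he y) \<in> borel_measurable borel"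
    using he_m by (intro borel_measurable_times borel_measurable_indicator) auto
  have "(LINT y:closure D|push_lebesgue \<Omega> w. h y) = (LINT y|push_lebesgue \<Omega> w. indicator (closure D) y * he y)"
    unfolding set_lebesgue_integral_def by (rule Bochner_Integration.integral_cong) (auto simp: indicator_def eq)
  also have "\<dots> = (LINT x|lebesgue_on \<Omega>. indicator (closure D) (w x) * he (w x))"
    unfolding push_lebesgue_def by (rule integral_distr[OF w ind])
  also have "\<dots> = (LINT x|lebesgue_on \<Omega>. he (w x))"
  proof (rule integral_cong_AE)
    show "AE x in lebesgue_on \<Omega>. indicator (closure D) (w x) * he (w x) = he (w x)"
      using wD by eventually_elim (use closure_subset in \<open>auto simp: indicator_def\<close>)
    show "(\<lambda>x. indicator (closure D) (w x) * he (w x)) \<in> borel_measurable (lebesgue_on \<Omega>)"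
      by (rule measurable_compose[OF w ind])
  qed measurable
  finally show "(LINT y:closure D|push_lebesgue \<Omega> w. h y) = (LINT x|lebesgue_on \<Omega>. he (w x))" .
  have "compact (he ` closure D)"
    using D he by (intro compact_continuous_image) (auto intro: continuous_on_subset simp: compact_closure)
  then obtain B where B: "\<And>y. y \<in> closure D \<Longrightarrow> norm (he y) \<le> B"
    by (meson bounded_iff compact_imp_bounded imageI)
  have "emeasure (lebesgue_on \<Omega>) (space (lebesgue_on \<Omega>)) < \<infinity>"
    using \<Omega> emeasure_bounded_finite[OF \<Omega>(2)] by (simp add: emeasure_restrict_space)
  then have "finite_measure (lebesgue_on \<Omega>)" by (intro finite_measureI) auto
  then show "integrable (lebesgue_on \<Omega>) (\<lambda>x. he (w x))"
  proof (rule finite_measure.integrable_const_bound)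
    show "AE x in lebesgue_on \<Omega>. norm (he (w x)) \<le> B"
      using wD by eventually_elim (use B closure_subset in blast)
  qed measurable
qed

section \<open>Finiteness of the bulk energy\<close>

lemma integrable_bulk_gradient_energy:
  fixes W :: "real ^ 'd \<Rightarrow> 'b::euclidean_space \<Rightarrow> real"
  assumes \<Omega>: "open \<Omega>" "bounded \<Omega>" and C: "C > 0" and W: "caratheodory_fun \<Omega> UNIV W"
    and growth: "AE x in lebesgue_on \<Omega>. \<forall>H. 1 / C * (norm H powr p - 1) \<le> W x H \<and> W x H \<le> C * (norm H powr p + 1)"
    and G: "Lp_fun (lebesgue_on \<Omega>) p G"
  shows "integrable (lebesgue_on \<Omega>) (\<lambda>x. W x (G x))"
proof (rule Bochner_Integration.integrable_bound)
  have "emeasure (lebesgue_on \<Omega>) (space (lebesgue_on \<Omega>)) < \<infinity>"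
    using \<Omega> emeasure_bounded_finite[OF \<Omega>(2)] by (simp add: emeasure_restrict_space)
  then interpret finite_measure "lebesgue_on \<Omega>" by (intro finite_measureI) auto
  show "integrable (lebesgue_on \<Omega>) (\<lambda>x. C * (norm (G x) powr p + 1) + 1 / C)"
    using G by (auto simp: Lp_fun_def)
  show "(\<lambda>x. W x (G x)) \<in> borel_measurable (lebesgue_on \<Omega>)"
    using G \<Omega> by (intro caratheodory_superposition_measurable[OF W]) (auto simp: Lp_fun_def)
  show "AE x in lebesgue_on \<Omega>. norm (W x (G x)) \<le> norm (C * (norm (G x) powr p + 1) + 1 / C)"
    using growth
  proof eventually_elim
    case (elim x)
    let ?a = "norm (G x) powr p"
    have lo: "1 / C * (?a - 1) \<le> W x (G x)" and up: "W x (G x) \<le> C * (?a + 1)" using elim by auto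
    have "1 / C * (?a - 1) = 1 / C * ?a - 1 / C" by (simp add: algebra_simps)
    moreover have "0 \<le> 1 / C * ?a" using C by simp
    ultimately have "- (1 / C) \<le> W x (G x)" using lo by linarith
    moreover have "0 \<le> C * (?a + 1)" "0 \<le> 1 / C" using C by auto
    ultimately show ?case unfolding real_norm_def using up by linarith
  qed
qed

text \<open>The integrability hypothesis concerns functions with values in \<open>D\<close> everywhere; redefining \<open>w\<close> on a
  null set makes it applicable.\<close>

lemma integrable_bulk_potential_energy:
  fixes F :: "real ^ 'd \<Rightarrow> 'b::euclidean_space \<Rightarrow> real"
  assumes \<Omega>: "open \<Omega>" and D: "open D" "d \<in> D" and F: "caratheodory_fun \<Omega> D F"
    and F_int: "\<And>w. w \<in> borel_measurable (lebesgue_on \<Omega>) \<Longrightarrow> (\<forall>x\<in>\<Omega>. w x \<in> D) \<Longrightarrow>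
          (\<integral>\<^sup>+x. ennreal \<bar>F x (w x)\<bar> \<partial>lebesgue_on \<Omega>) < \<infinity>"
    and w[measurable]: "w \<in> borel_measurable (lebesgue_on \<Omega>)" and wD: "AE x in lebesgue_on \<Omega>. w x \<in> D"
  shows "integrable (lebesgue_on \<Omega>) (\<lambda>x. F x (w x))"
proof (rule integrableI_bounded)
  show "(\<lambda>x. F x (w x)) \<in> borel_measurable (lebesgue_on \<Omega>)"
    using \<Omega> by (intro caratheodory_superposition_measurable[OF F _ w wD]) auto
  have "(\<lambda>y. if y \<in> D then y else d) \<in> borel_measurable borel"
    using D by (intro measurable_If_set) auto
  from measurable_compose[OF w this]
  have w': "(\<lambda>x. if w x \<in> D then w x else d) \<in> borel_measurable (lebesgue_on \<Omega>)" .
  have "(\<integral>\<^sup>+x. ennreal (norm (F x (w x))) \<partial>lebesgue_on \<Omega>)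
    = (\<integral>\<^sup>+x. ennreal \<bar>F x (if w x \<in> D then w x else d)\<bar> \<partial>lebesgue_on \<Omega>)"
    using wD by (intro nn_integral_cong_AE) (auto elim: eventually_mono)
  also have "\<dots> < \<infinity>"
    using D w' by (intro F_int) auto
  finally show "(\<integral>\<^sup>+x. ennreal (norm (F x (w x))) \<partial>lebesgue_on \<Omega>) < \<infinity>" .
qed

section \<open>Global minimality\<close>

theorem theorem3p2:
  fixes \<Omega> :: "(real ^ 'd) set" and D :: "(real ^ 'k) set"
    and W :: "real ^ 'd \<Rightarrow> real ^ 'd ^ 'k \<Rightarrow> real" and DW :: "real ^ 'd \<Rightarrow> real ^ 'd ^ 'k \<Rightarrow> real ^ 'd ^ 'k"
    and F :: "real ^ 'd \<Rightarrow> real ^ 'k \<Rightarrow> real" and DF :: "real ^ 'd \<Rightarrow> real ^ 'k \<Rightarrow> real ^ 'k"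
    and p C :: real
    and g u :: "real ^ 'd \<Rightarrow> real ^ 'k"
    and \<Phi> :: "(real ^ 'k) measure \<Rightarrow> ereal"
    and \<omega> \<omega>e :: "real ^ 'k \<Rightarrow> real" and \<xi> :: "real ^ 'k \<Rightarrow> real ^ 'k"
  assumes Omega: "bounded_lipschitz_domain \<Omega>" and D: "bounded_lipschitz_domain D"
    and C_p: "C > 0" "p > 1"
    and W_caratheodory: "caratheodory_fun \<Omega> UNIV W"
    and W_growth: "AE x in lebesgue_on \<Omega>. \<forall>H.
          1 / C * (norm H powr p - 1) \<le> W x H \<and> W x H \<le> C * (norm H powr p + 1)"
    and W_convex: "AE x in lebesgue_on \<Omega>. convex_on UNIV (W x)"
    and DW: "AE x in lebesgue_on \<Omega>. \<forall>H. GDERIV (W x) H :> DW x H"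
    and F_caratheodory: "caratheodory_fun \<Omega> D F"
    and F_integrable: "\<And>w. w \<in> borel_measurable (lebesgue_on \<Omega>) \<Longrightarrow> (\<forall>x\<in>\<Omega>. w x \<in> D) \<Longrightarrow>
          (\<integral>\<^sup>+x. ennreal \<bar>F x (w x)\<bar> \<partial>lebesgue_on \<Omega>) < \<infinity>"
    and F_convex: "AE x in lebesgue_on \<Omega>. convex_fun_on D (F x)"
    and DF: "AE x in lebesgue_on \<Omega>. \<forall>y\<in>D. GDERIV (F x) y :> DF x y"
    and g: "g ` frontier \<Omega> \<subseteq> frontier D" "g ` \<Omega> = D"
    and Phi_convex: "convex_on_measures D \<Phi>"
    and Phi_bounded_below: "\<exists>m::real. \<forall>\<mu>\<in>pos_measures D. ereal m \<le> \<Phi> \<mu>"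
    and Phi_lsc: "weak_star_lsc D \<Phi>"
    and u: "u \<in> sobolev_bdry \<Omega> D p g"
    and omega: "\<omega> \<in> measure_subdifferential D \<Phi> (push_lebesgue \<Omega> u)"
    and omega_extension: "convex_on UNIV \<omega>e" "\<forall>y\<in>closure D. \<omega>e y = \<omega> y"
    and xi: "\<xi> \<in> borel_measurable (restrict_space borel D)"
          "\<forall>y\<in>D. \<xi> y \<in> convex_subdifferential \<omega>e y"
    and Euler_Lagrange: "\<And>v. v \<in> sobolev_zero \<Omega> p \<Longrightarrow>
          has_bochner_integral (lebesgue_on \<Omega>)
            (\<lambda>x. weak_grad \<Omega> v x \<bullet> DW x (weak_grad \<Omega> u x) + v x \<bullet> (DF x (u x) + \<xi> (u x))) 0"
  shows "is_global_minimizer (energy \<Omega> W F \<Phi>) (sobolev_bdry \<Omega> D p g) u \<and>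
    (strictly_convex_fun_on (closure D) \<omega>
      \<or> (AE x in lebesgue_on \<Omega>. strictly_convex_fun_on D (F x))
      \<or> (AE x in lebesgue_on \<Omega>. strictly_convex_fun_on UNIV (W x)) \<longrightarrow>
     (\<forall>w. is_global_minimizer (energy \<Omega> W F \<Phi>) (sobolev_bdry \<Omega> D p g) w \<longrightarrow>
       (AE x in lebesgue_on \<Omega>. w x = u x)))"
proof -
  have \<Omega>: "open \<Omega>" "bounded \<Omega>" using Omega by (auto simp: bounded_lipschitz_domain_def)
  have Do: "open D" "bounded D" using D by (auto simp: bounded_lipschitz_domain_def)
  obtain d where d: "d \<in> D" using D by (auto simp: bounded_lipschitz_domain_def)
  let ?S = "sobolev_bdry \<Omega> D p g"
  let ?L = "lebesgue_on \<Omega>"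
  have \<omega>e_cont: "continuous_on UNIV \<omega>e"
    using omega_extension(1) by (intro convex_on_continuous) auto
  define bulk where "bulk w x = W x (weak_grad \<Omega> w x) + F x (w x)" for w x
  have meas: "w \<in> borel_measurable ?L" and inD: "AE x in ?L. w x \<in> D" and sob: "w \<in> sobolev \<Omega> p"
    if "w \<in> ?S" for w
    using that by (auto simp: sobolev_bdry_def sobolev_def Lp_fun_def)
  have bulk_int: "integrable ?L (bulk w)" if "w \<in> ?S" for w
    unfolding bulk_def
  proof (rule Bochner_Integration.integrable_add)
    show "integrable ?L (\<lambda>x. W x (weak_grad \<Omega> w x))"
      by (rule integrable_bulk_gradient_energy[OF \<Omega> C_p(1) W_caratheodory W_growth weak_grad_sobolev(2)[OF \<Omega>(1) sob[OF that]]])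
    show "integrable ?L (\<lambda>x. F x (w x))"
      by (rule integrable_bulk_potential_energy[OF \<Omega>(1) Do(1) d F_caratheodory F_integrable meas[OF that] inD[OF that]])
  qed
  have push: "push_lebesgue \<Omega> w \<in> pos_measures D" if "w \<in> ?S" for w
    by (rule push_lebesgue_in_pos_measures[OF \<Omega> meas[OF that] inD[OF that]])
  have \<omega>_push: "(LINT y:closure D|push_lebesgue \<Omega> w. \<omega> y) = (LINT x|?L. \<omega>e (w x))"
    and \<omega>_int: "integrable ?L (\<lambda>x. \<omega>e (w x))" if "w \<in> ?S" for w
    using integral_push_lebesgue[OF \<Omega> Do(2) meas[OF that] inD[OF that] \<omega>e_cont, of \<omega>] omega_extension(2) by auto
  have \<Phi>_ne: "\<Phi> \<mu> \<noteq> - \<infinity>" if "\<mu> \<in> pos_measures D" for \<mu>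
    using Phi_bounded_below that by fastforce
  have \<Phi>_u: "\<Phi> (push_lebesgue \<Omega> u) < \<infinity>" using omega by (simp add: measure_subdifferential_def)
  then obtain c where c: "\<Phi> (push_lebesgue \<Omega> u) = ereal c"
    using \<Phi>_ne[OF push[OF u]] by (cases "\<Phi> (push_lebesgue \<Omega> u)") auto
  \<comment> \<open>The deficits in the three tangent inequalities at \<open>u\<close>; they are nonnegative, and zero where a tangent touches again.\<close>
  define gapW where "gapW w x = W x (weak_grad \<Omega> w x) - W x (weak_grad \<Omega> u x)
      - DW x (weak_grad \<Omega> u x) \<bullet> (weak_grad \<Omega> w x - weak_grad \<Omega> u x)" for w x
  define gapF where "gapF w x = F x (w x) - F x (u x) - DF x (u x) \<bullet> (w x - u x)" for w x
  define gap\<omega> where "gap\<omega> w x = \<omega>e (w x) - \<omega>e (u x) - \<xi> (u x) \<bullet> (w x - u x)" for w x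
  define gap where "gap w x = gapW w x + gapF w x + gap\<omega> w x" for w x
  have gapW: "AE x in ?L. 0 \<le> gapW w x" for w
    using W_convex DW
  proof eventually_elim
    case (elim x)
    then have "GDERIV (W x) (weak_grad \<Omega> u x) :> DW x (weak_grad \<Omega> u x)" by blast
    from convex_fun_on_above_tangent[OF open_UNIV convex_fun_on_UNIV[OF elim(1)] UNIV_I UNIV_I this, of "weak_grad \<Omega> w x"]
    show ?case by (simp add: gapW_def)
  qed
  have gapF: "AE x in ?L. 0 \<le> gapF w x" if "w \<in> ?S" for w
    using F_convex DF inD[OF that] inD[OF u]
  proof eventually_elim
    case (elim x)
    then show ?case
      using convex_fun_on_above_tangent[OF Do(1) elim(1,4,3), of "DF x (u x)"]
      by (simp add: gapF_def algebra_simps)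
  qed
  have gap\<omega>: "AE x in ?L. 0 \<le> gap\<omega> w x" for w
    using inD[OF u]
  proof eventually_elim
    case (elim x)
    then have "\<xi> (u x) \<in> convex_subdifferential \<omega>e (u x)" using xi(2) by blast
    then have "\<omega>e (u x) + \<xi> (u x) \<bullet> (w x - u x) \<le> \<omega>e (w x)" by (simp add: convex_subdifferential_def)
    then show ?case by (simp add: gap\<omega>_def)
  qed
  have gap_nonneg: "AE x in ?L. 0 \<le> gap w x" if "w \<in> ?S" for w
    using gapW[of w] gapF[OF that] gap\<omega>[of w] by eventually_elim (simp add: gap_def)
  have gap_int: "integrable ?L (gap w)"
    and gap_eq: "(LINT x|?L. bulk w x) + (LINT x|?L. \<omega>e (w x)) = (LINT x|?L. bulk u x) + (LINT x|?L. \<omega>e (u x)) + (LINT x|?L. gap w x)"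
    if w: "w \<in> ?S" for w
  proof -
    let ?v = "\<lambda>x. w x - u x"
    \<comment> \<open>The linear parts of the three tangents add up to the Euler--Lagrange integrand tested with \<open>w - u\<close>, which integrates to zero.\<close>
    let ?EL = "\<lambda>x. weak_grad \<Omega> ?v x \<bullet> DW x (weak_grad \<Omega> u x) + ?v x \<bullet> (DF x (u x) + \<xi> (u x))"
    note v = sobolev_bdry_diff[OF \<Omega>(1) _ w u]
    have EL: "has_bochner_integral ?L ?EL 0"
      using C_p(2) by (intro Euler_Lagrange v) auto
    let ?g = "\<lambda>x. (bulk w x + \<omega>e (w x)) - (bulk u x + \<omega>e (u x)) - ?EL x"
    have "AE x in ?L. weak_grad \<Omega> ?v x = weak_grad \<Omega> w x - weak_grad \<Omega> u x"
      using C_p(2) by (intro v) auto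
    then have eq: "AE x in ?L. gap w x = ?g x"
      by eventually_elim
        (simp add: gap_def gapW_def gapF_def gap\<omega>_def bulk_def inner_commute inner_add_left inner_add_right)
    have sum_int: "integrable ?L (\<lambda>x. bulk w x + \<omega>e (w x))" "integrable ?L (\<lambda>x. bulk u x + \<omega>e (u x))"
      using bulk_int[OF w] bulk_int[OF u] \<omega>_int[OF w] \<omega>_int[OF u] by auto
    have "has_bochner_integral ?L ?g ((LINT x|?L. bulk w x + \<omega>e (w x)) - (LINT x|?L. bulk u x + \<omega>e (u x)) - 0)"
      by (intro has_bochner_integral_diff EL has_bochner_integral_integrable sum_int)
    then have g: "integrable ?L ?g" "(LINT x|?L. ?g x) = (LINT x|?L. bulk w x + \<omega>e (w x)) - (LINT x|?L. bulk u x + \<omega>e (u x))"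
      by (auto simp: has_bochner_integral_iff)
    have gm: "gap w \<in> borel_measurable ?L"
      using \<Omega>(1) eq by (intro borel_measurable_lebesgue_on_AE[OF borel_measurable_integrable[OF g(1)]]) (auto elim: eventually_mono)
    show "integrable ?L (gap w)"
      using eq by (intro integrable_cong_AE_imp[OF g(1) gm]) (auto elim: eventually_mono)
    have "(LINT x|?L. gap w x) = (LINT x|?L. ?g x)"
      by (rule integral_cong_AE[OF gm borel_measurable_integrable[OF g(1)] eq])
    then show "(LINT x|?L. bulk w x) + (LINT x|?L. \<omega>e (w x)) = (LINT x|?L. bulk u x) + (LINT x|?L. \<omega>e (u x)) + (LINT x|?L. gap w x)"
      using g(2) bulk_int[OF w] bulk_int[OF u] \<omega>_int[OF w] \<omega>_int[OF u] by simp
  qed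
  have energy_ge: "energy \<Omega> W F \<Phi> u + ereal (LINT x|?L. gap w x) \<le> energy \<Omega> W F \<Phi> w" if w: "w \<in> ?S" for w
  proof -
    have "\<Phi> (push_lebesgue \<Omega> u) + ereal ((LINT x|?L. \<omega>e (w x)) - (LINT x|?L. \<omega>e (u x))) \<le> \<Phi> (push_lebesgue \<Omega> w)"
      using measure_subdifferentialD[OF omega push[OF w]]
      by (simp add: \<omega>_push w u)
    from add_left_mono[OF this, of "ereal (LINT x|?L. bulk w x)"] gap_eq[OF w] show ?thesis
      by (simp add: energy_def bulk_def[symmetric] c add.assoc[symmetric]) (simp add: algebra_simps)
  qed
  have gap_integral: "0 \<le> (LINT x|?L. gap w x)" if "w \<in> ?S" for w
    using gap_nonneg[OF that] by (rule integral_nonneg_AE)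
  have energy_u: "energy \<Omega> W F \<Phi> u = ereal ((LINT x|?L. bulk u x) + c)"
    by (simp add: energy_def bulk_def c)
  have "is_global_minimizer (energy \<Omega> W F \<Phi>) ?S u"
    unfolding is_global_minimizer_def
  proof (intro conjI ballI u)
    fix w assume "w \<in> ?S"
    then have "energy \<Omega> W F \<Phi> u \<le> energy \<Omega> W F \<Phi> u + ereal (LINT x|?L. gap w x)"
      using gap_integral by (simp add: energy_u)
    also have "\<dots> \<le> energy \<Omega> W F \<Phi> w" by (rule energy_ge[OF \<open>w \<in> ?S\<close>])
    finally show "energy \<Omega> W F \<Phi> u \<le> energy \<Omega> W F \<Phi> w" .
  qed
  moreover have "AE x in ?L. w x = u x"
    if strict: "strictly_convex_fun_on (closure D) \<omega>
      \<or> (AE x in ?L. strictly_convex_fun_on D (F x))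
      \<or> (AE x in ?L. strictly_convex_fun_on UNIV (W x))"
      and min: "is_global_minimizer (energy \<Omega> W F \<Phi>) ?S w" for w
  proof -
    have w: "w \<in> ?S" and le: "energy \<Omega> W F \<Phi> w \<le> energy \<Omega> W F \<Phi> u"
      using min u by (auto simp: is_global_minimizer_def)
    have "ereal ((LINT x|?L. bulk u x) + c) + ereal (LINT x|?L. gap w x) \<le> ereal ((LINT x|?L. bulk u x) + c)"
      using order_trans[OF energy_ge[OF w] le] by (simp add: energy_u)
    then have "(LINT x|?L. gap w x) = 0" using gap_integral[OF w] by simp
    then have "AE x in ?L. gap w x = 0"
      using integral_nonneg_eq_0_iff_AE[OF gap_int[OF w] gap_nonneg[OF w]] by simp
    \<comment> \<open>Equal energies force each of the three nonnegative deficits to vanish.\<close>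
    then have zero: "AE x in ?L. gapW w x = 0 \<and> gapF w x = 0 \<and> gap\<omega> w x = 0"
      using gapW[of w] gapF[OF w] gap\<omega>[of w] by eventually_elim (auto simp: gap_def)
    from strict show ?thesis
    proof (elim disjE)
      assume s: "strictly_convex_fun_on (closure D) \<omega>"
      show ?thesis
        using zero inD[OF w] inD[OF u]
      proof eventually_elim
        case (elim x)
        have cl: "y \<in> D \<Longrightarrow> \<omega>e y = \<omega> y" for y using omega_extension(2) closure_subset[of D] by blast
        have "\<xi> (u x) \<in> convex_subdifferential \<omega>e (u x)" using xi(2) elim by blast
        then have "\<omega> (u x) + \<xi> (u x) \<bullet> (m - u x) \<le> \<omega> m" if "m \<in> D" for m
          using that elim by (simp add: convex_subdifferential_def cl[symmetric])
        moreover have "\<omega> (w x) = \<omega> (u x) + \<xi> (u x) \<bullet> (w x - u x)"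
          using elim by (simp add: gap\<omega>_def cl)
        ultimately show ?case
          using elim closure_subset[of D]
          by (intro strictly_convex_touches_tangent_once[OF s Do(1) closure_subset elim(3)]) auto
      qed
    next
      assume s: "AE x in ?L. strictly_convex_fun_on D (F x)"
      show ?thesis
        using zero inD[OF w] inD[OF u] s DF
      proof eventually_elim
        case (elim x)
        have "convex_fun_on D (F x)" using elim(4) by (simp add: strictly_convex_fun_on_def)
        from convex_fun_on_above_tangent[OF Do(1) this elim(3)]
        have "F x (u x) + DF x (u x) \<bullet> (m - u x) \<le> F x m" if "m \<in> D" for m
          using that elim(3,5) by blast
        then show ?case
          using elim by (intro strictly_convex_touches_tangent_once[OF elim(4) Do(1) subset_refl elim(3,2)])
            (auto simp: gapF_def)
      qed
    next
      assume s: "AE x in ?L. strictly_convex_fun_on UNIV (W x)"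
      have "AE x in ?L. weak_grad \<Omega> w x = weak_grad \<Omega> u x"
        using zero s DW
      proof eventually_elim
        case (elim x)
        have "convex_fun_on UNIV (W x)" using elim(2) by (simp add: strictly_convex_fun_on_def)
        from convex_fun_on_above_tangent[OF open_UNIV this UNIV_I UNIV_I]
        have "W x (weak_grad \<Omega> u x) + DW x (weak_grad \<Omega> u x) \<bullet> (m - weak_grad \<Omega> u x) \<le> W x m" for m
          using elim(3) by blast
        then show ?case
          using elim by (intro strictly_convex_touches_tangent_once[OF elim(2) open_UNIV subset_refl UNIV_I UNIV_I])
            (auto simp: gapW_def)
      qed
      moreover have "AE x in ?L. weak_grad \<Omega> (\<lambda>x. w x - u x) x = weak_grad \<Omega> w x - weak_grad \<Omega> u x"
        using C_p(2) by (intro sobolev_bdry_diff(2)[OF \<Omega>(1) _ w u]) auto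
      \<comment> \<open>Strict convexity in the gradient only identifies the gradients; the common boundary values do the rest.\<close>
      ultimately have "AE x in ?L. weak_grad \<Omega> (\<lambda>x. w x - u x) x = 0"
        by eventually_elim simp
      moreover have "(\<lambda>x. w x - u x) \<in> sobolev_zero \<Omega> p"
        using C_p(2) by (intro sobolev_bdry_diff(1)[OF \<Omega>(1) _ w u]) auto
      ultimately have "AE x in ?L. w x - u x = 0"
        using C_p(2) by (intro sobolev_zero_vanishes_if_gradient_vanishes[OF \<Omega>]) auto
      then show ?thesis by eventually_elim simp
    qed
  qed
  ultimately show ?thesis by blast
qed

end
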